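(* Under the setting and Assumptions A1–A4 described in the context, let $\{\mathcal{X}^t\}_{t\in\mathbb{N}}$ be the sequence generated by the TNNR iteration. Then: (i) $\{\mathcal{X}^t\}$ is bounded and has at least one accumulation point, i.e. there exist $\mathcal{X}^\star$ and a subsequence $\{\mathcal{X}^{t_l}\}$ with $\lim_{l\to\infty}\mathcal{X}^{t_l}=\mathcal{X}^\star$; (ii) the sequence $\{F(\mathcal{X}^t)\}$ is convergent; (iii) every accumulation point $\mathcal{X}^\star=\lim_{l\to\infty}\mathcal{X}^{t_l}$ of $\{\mathcal{X}^t\}$ is a stationary point of $F$, i.e. $0\in\partial F(\mathcal{X}^\star)$ (limiting subdifferential), and moreover $F(\mathcal{X}^{t_l+1})\to F(\mathcal{X}^\star)$ as $l\to\infty$.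
   Context: Tensors: fix positive integers $n_1,n_2,n_3$, let $r=\min\{n_1,n_2\}$. For $\mathcal{X}\in\mathbb{R}^{n_1\times n_2\times n_3}$, $\|\mathcal{X}\|$ is the Frobenius norm (square root of the sum of squared entries) and $\langle\cdot,\cdot\rangle$ the entrywise inner product. $\bar{\mathcal{X}}\in\mathbb{C}^{n_1\times n_2\times n_3}$ is the (unnormalized) discrete Fourier transform of $\mathcal{X}$ along the third mode, $\bar{\mathcal{X}}(i,j,:)=F_{n_3}\mathcal{X}(i,j,:)$ with $F_{n_3}$ the $n_3\times n_3$ DFT matrix $(\omega^{(p-1)(q-1)})_{p,q}$, $\omega=e^{-2\pi\sqrt{-1}/n_3}$; $\bar X^{(k)}$ is its $k$-th frontal slice, and $\sigma_i^k(\mathcal{X})$ denotes the $i$-th largest singular value of $\bar X^{(k)}$, $i\in[r]$, $k\in[n_3]$. Assumption A1: $\rho:[0,\infty)\to[0,\infty)$ is differentiable and concave, $\rho'$ is Lipschitz continuous with constant $L_g$, and $\rho'(t)>0$ for all $t\ge 0$. Assumption A2: $f:\mathbb{R}^{n_1\times n_2\times n_3}\to[0,\infty)$ is continuously differentiable and $\nabla f$ is $L_f$-Lipschitz ($L_f>0$). Objective: for $\lambda>0$, $F(\mathcal{X})=\lambda\sum_{k=1}^{n_3}\rho\Big(\sum_{i=1}^r\rho\big(\rho(\sigma_i^k(\mathcal{X}))\big)\Big)+f(\mathcal{X})$. Assumption A3: $F$ is coercive ($F(\mathcal{X})\to+\infty$ as $\|\mathcal{X}\|\to\infty$) and bounded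 below. Weighted function: for weights $\alpha=(\alpha_k)_{k\in[n_3]}$, $\beta=(\beta_i^k)$, $\|\mathcal{X}\|_{\rho_\alpha^\beta}=\sum_{k=1}^{n_3}\sum_{i=1}^r\alpha_k\beta_i^k\rho(\sigma_i^k(\mathcal{X}))$. TNNR iteration: start from $\mathcal{X}^0$ and set $\mathcal{X}^{-1}=\mathcal{X}^0$; for every $t\ge 0$ the weights are $\alpha_k^t=\rho'\big(\sum_{i=1}^r\rho(\rho(\sigma_i^k(\mathcal{X}^t)))\big)$, $\beta_i^{k,t}=\rho'\big(\rho(\sigma_i^k(\mathcal{X}^t))\big)$, and $\mathcal{Y}^t=\mathcal{X}^t+\theta_1^t(\mathcal{X}^t-\mathcal{X}^{t-1})$, $\mathcal{Z}^t=\mathcal{X}^t+\theta_2^t(\mathcal{X}^t-\mathcal{X}^{t-1})$, $\mathcal{X}^{t+1}\in\arg\min_{\mathcal{X}}\ \lambda\|\mathcal{X}\|_{\rho_{\alpha^t}^{\beta^t}}+\langle\mathcal{X}-\mathcal{Y}^t,\nabla f(\mathcal{Z}^t)\rangle+\frac{\mu^t}{2}\|\mathcal{X}-\mathcal{Y}^t\|^2$ (a global minimizer). Assumption A4: for some fixed $\varepsilon\in(0,1)$ and all $t$: $\theta_1^t\in[0,(1-\varepsilon)/2)$, $\theta_2^t\in[0,1/2]$, $(\mu^t)$ is nonincreasing and $\mu^0\ge\mu^t\ge\max\{\theta_2^tL_f/\theta_1^t,\ (1-\theta_2^t)L_f/(1-\theta_1^t-\theta_1^{t+1}-\varepsilon)\}$.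 *)

theory Defs
  imports "HOL-Analysis.Analysis" "Jordan_Normal_Form.Char_Poly"
begin

text \<open>Third-order real tensors of size n1 x n2 x n3 are represented as functions
  nat => nat => nat => real (0-based indices) that vanish outside the index box.\<close>

type_synonym tensor = "nat \<Rightarrow> nat \<Rightarrow> nat \<Rightarrow> real"

definition tensors :: "nat \<Rightarrow> nat \<Rightarrow> nat \<Rightarrow> tensor set" where
  "tensors n1 n2 n3 = {X. \<forall>i j k. \<not> (i < n1 \<and> j < n2 \<and> k < n3) \<longrightarrow> X i j k = 0}"

definition t_inner :: "nat \<Rightarrow> nat \<Rightarrow> nat \<Rightarrow> tensor \<Rightarrow> tensor \<Rightarrow> real" where
  "t_inner n1 n2 n3 X Y = (\<Sum>i<n1. \<Sum>j<n2. \<Sum>k<n3. X i j k * Y i j k)"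

definition t_norm :: "nat \<Rightarrow> nat \<Rightarrow> nat \<Rightarrow> tensor \<Rightarrow> real" where
  "t_norm n1 n2 n3 X = sqrt (t_inner n1 n2 n3 X X)"

definition t_zero :: tensor where "t_zero = (\<lambda>i j k. 0)"

definition t_diff :: "tensor \<Rightarrow> tensor \<Rightarrow> tensor" where
  "t_diff X Y = (\<lambda>i j k. X i j k - Y i j k)"

definition t_extrap :: "tensor \<Rightarrow> real \<Rightarrow> tensor \<Rightarrow> tensor" where
  "t_extrap X c W = (\<lambda>i j k. X i j k + c * (X i j k - W i j k))"

definition dft3 :: "nat \<Rightarrow> tensor \<Rightarrow> nat \<Rightarrow> nat \<Rightarrow> nat \<Rightarrow> complex" where
  "dft3 n3 X i j k = (\<Sum>q<n3. cis (- 2 * pi / real n3) ^ (k * q) * complex_of_real (X i j q))"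

definition eigvals_list :: "complex mat \<Rightarrow> complex list" where
  "eigvals_list A = (SOME as. char_poly A = (\<Prod>a\<leftarrow>as. [:- a, 1:]) \<and> length as = dim_row A)"

text \<open>Singular values of an m x n complex matrix A (given entrywise, 0-based), in
  nonincreasing order: square roots of the eigenvalues of A^H A.
  sing_val m n A i is the (i+1)-th largest singular value.\<close>
definition sing_val :: "nat \<Rightarrow> nat \<Rightarrow> (nat \<Rightarrow> nat \<Rightarrow> complex) \<Rightarrow> nat \<Rightarrow> real" where
  "sing_val m n A i =
     rev (sort (map (\<lambda>a. sqrt (Re a))
       (eigvals_list (mat n n (\<lambda>(p, q). \<Sum>l<m. cnj (A l p) * A l q))))) ! i"

definition tsv :: "nat \<Rightarrow> nat \<Rightarrow> nat \<Rightarrow> tensor \<Rightarrow> nat \<Rightarrow> nat \<Rightarrow> real" where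
  "tsv n1 n2 n3 X i k = sing_val n1 n2 (\<lambda>a b. dft3 n3 X a b k) i"

definition objF :: "nat \<Rightarrow> nat \<Rightarrow> nat \<Rightarrow> (real \<Rightarrow> real) \<Rightarrow> real \<Rightarrow> (tensor \<Rightarrow> real) \<Rightarrow> tensor \<Rightarrow> real" where
  "objF n1 n2 n3 \<rho> lam f X =
     lam * (\<Sum>k<n3. \<rho> (\<Sum>i<min n1 n2. \<rho> (\<rho> (tsv n1 n2 n3 X i k)))) + f X"

definition wnorm :: "nat \<Rightarrow> nat \<Rightarrow> nat \<Rightarrow> (real \<Rightarrow> real) \<Rightarrow> (nat \<Rightarrow> real) \<Rightarrow> (nat \<Rightarrow> nat \<Rightarrow> real) \<Rightarrow> tensor \<Rightarrow> real" where
  "wnorm n1 n2 n3 \<rho> \<alpha> \<beta> X = (\<Sum>k<n3. \<Sum>i<min n1 n2. \<alpha> k * \<beta> i k * \<rho> (tsv n1 n2 n3 X i k))"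

text \<open>Frechet (regular) subdifferential on the tensor space (Frobenius geometry):
  V is a Frechet subgradient of F at X iff
  liminf_{Y -> X, Y ~= X} (F Y - F X - <V, Y - X>) / ||Y - X|| >= 0.\<close>
definition frechet_subdiff :: "nat \<Rightarrow> nat \<Rightarrow> nat \<Rightarrow> (tensor \<Rightarrow> real) \<Rightarrow> tensor \<Rightarrow> tensor set" where
  "frechet_subdiff n1 n2 n3 F X = {V \<in> tensors n1 n2 n3.
     \<forall>\<epsilon>>0. \<exists>\<delta>>0. \<forall>Y\<in>tensors n1 n2 n3. t_norm n1 n2 n3 (t_diff Y X) < \<delta> \<longrightarrow>
        F Y \<ge> F X + t_inner n1 n2 n3 V (t_diff Y X) - \<epsilon> * t_norm n1 n2 n3 (t_diff Y X)}"

text \<open>Limiting subdifferential (sequences converging entrywise, i.e. in Frobenius norm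
  on the finite-dimensional tensor space).\<close>
definition limiting_subdiff :: "nat \<Rightarrow> nat \<Rightarrow> nat \<Rightarrow> (tensor \<Rightarrow> real) \<Rightarrow> tensor \<Rightarrow> tensor set" where
  "limiting_subdiff n1 n2 n3 F X = {V \<in> tensors n1 n2 n3.
     \<exists>Xs Vs. (\<forall>t. Xs t \<in> tensors n1 n2 n3 \<and> Vs t \<in> frechet_subdiff n1 n2 n3 F (Xs t)) \<and>
       Xs \<longlonglongrightarrow> X \<and> (\<lambda>t. F (Xs t)) \<longlonglongrightarrow> F X \<and> Vs \<longlonglongrightarrow> V}"

end

theory Submission
  imports Defs
begin

text \<open>
  Write \<open>F = lam * reg + f\<close> and let \<open>lin V\<close> be the weighted function whose weights are taken at \<open>V\<close>.
  Concavity of \<open>\<rho>\<close> gives \<open>reg W - reg V \<le> lin V W - lin V V\<close>. Combined with the minimality of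
  \<open>X (Suc t)\<close> and the quadratic bounds for \<open>f\<close> at the point \<open>Z\<close>, this makes the energy
  \<open>F (X t) + \<mu> t / 2 * \<theta>1 t * \<parallel>X t - X (t - 1)\<parallel>\<^sup>2\<close> decrease by at least a multiple of
  \<open>\<parallel>X (Suc t) - X t\<parallel>\<^sup>2\<close>. Hence the iterates are bounded, \<open>F\<close> converges along them, and consecutive
  differences tend to zero.

  An accumulation point \<open>Xs\<close> therefore minimizes the limit subproblem
  \<open>lam * lin Xs W + \<langle>W - Xs, gf Xs\<rangle> + \<mu> 0 / 2 * \<parallel>W - Xs\<parallel>\<^sup>2\<close>. Since \<open>\<rho>'\<close> and the singular values are
  Lipschitz, \<open>reg\<close> exceeds its linearization \<open>lin Xs\<close> up to an error \<open>O(\<parallel>W - Xs\<parallel>\<^sup>2)\<close>, so \<open>F\<close> has a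
  quadratic minorant touching it at \<open>Xs\<close> with slope zero: zero is even a Frechet subgradient.
  No subdifferential calculus for spectral functions is needed.

  The Lipschitz bound for singular values (Weyl) rests on a spectral basis of the Gram matrix built by
  successively maximizing the Rayleigh quotient on orthogonal complements, so that the eigenvalues
  come out sorted together with their variational characterization.
\<close>

section \<open>Spectral bases of Hermitian matrices\<close>

text \<open>Tychonoff. Vectors and tensors are bare functions on \<open>nat\<close>, so compactness
  has to be taken in the product topology, with every coordinate confined, those outside the index
  range included.\<close>

lemma compact_fun_box:
  fixes K :: "'a \<Rightarrow> 'b::topological_space set"
  assumes "\<And>i. compact (K i)"
  shows "compact {g. \<forall>i. g i \<in> K i}"
proof -
  have "compactin (product_topology (\<lambda>_::'a. euclidean :: 'b topology) UNIV) (PiE UNIV K)"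
    using assms by (simp add: compactin_PiE)
  moreover have "PiE UNIV K = {g. \<forall>i. g i \<in> K i}" by auto
  ultimately show ?thesis by (simp add: euclidean_product_topology)
qed

lemma continuous_on_coordinate: "continuous_on S (\<lambda>g :: 'a \<Rightarrow> 'b::topological_space. g i)"
  by (rule continuous_on_subset[OF continuous_on_product_coordinates subset_UNIV])

lemma tendsto_fun_iff:
  fixes g :: "'a \<Rightarrow> 'i \<Rightarrow> 'b::topological_space"
  shows "(g \<longlongrightarrow> l) F \<longleftrightarrow> (\<forall>i. ((\<lambda>x. g x i) \<longlongrightarrow> l i) F)"
proof -
  have "(g \<longlongrightarrow> l) F \<longleftrightarrow> limitin (product_topology (\<lambda>_. euclidean) UNIV) g l F"
    by (simp add: euclidean_product_topology)
  also have "\<dots> \<longleftrightarrow> (\<forall>i. ((\<lambda>x. g x i) \<longlongrightarrow> l i) F)"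
    by (subst limitin_componentwise) auto
  finally show ?thesis .
qed

text \<open>Padding the \<open>k\<close> equations with zero rows gives a square matrix whose row
  \<open>k\<close> vanishes. Laplace expansion along that row makes it singular, and a kernel vector
  is the solution.\<close>

lemma underdetermined_system:
  fixes c :: "nat \<Rightarrow> nat \<Rightarrow> 'a::field"
  assumes "k < n"
  obtains x where "\<exists>p<n. x p \<noteq> 0" "\<And>j. j < k \<Longrightarrow> (\<Sum>p<n. c j p * x p) = 0"
proof -
  define C where "C = mat n n (\<lambda>(j, p). if j < k then c j p else 0)"
  have C: "C \<in> carrier_mat n n" by (simp add: C_def)
  have "det C = 0"
    using assms by (subst laplace_expansion_row[OF C assms]) (auto simp: C_def intro!: sum.neutral)
  then obtain v where v: "v \<in> carrier_vec n" "v \<noteq> 0\<^sub>v n" "C *\<^sub>v v = 0\<^sub>v n"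
    using det_0_iff_vec_prod_zero[OF C] by blast
  show ?thesis
  proof
    show "\<exists>p<n. v $ p \<noteq> 0" using v(1,2) by (metis carrier_vecD dim_vec eq_vecI index_zero_vec(1) index_zero_vec(2))
    fix j assume "j < k"
    then have "(C *\<^sub>v v) $ j = 0" using v(3) assms by simp
    then show "(\<Sum>p<n. c j p * v $ p) = 0"
      using \<open>j < k\<close> assms v(1) by (simp add: C_def scalar_prod_def lessThan_atLeast0)
  qed
qed

section \<open>The Hermitian inner product, conjugate-linear in its first argument\<close>

definition cinner :: "nat \<Rightarrow> (nat \<Rightarrow> complex) \<Rightarrow> (nat \<Rightarrow> complex) \<Rightarrow> complex" where
  "cinner n u v = (\<Sum>p<n. cnj (u p) * v p)"

definition sqnorm :: "nat \<Rightarrow> (nat \<Rightarrow> complex) \<Rightarrow> real" where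
  "sqnorm n v = (\<Sum>p<n. (cmod (v p))\<^sup>2)"

definition mat_apply :: "nat \<Rightarrow> (nat \<Rightarrow> nat \<Rightarrow> complex) \<Rightarrow> (nat \<Rightarrow> complex) \<Rightarrow> nat \<Rightarrow> complex" where
  "mat_apply n M v p = (\<Sum>q<n. M p q * v q)"

definition hermitian :: "nat \<Rightarrow> (nat \<Rightarrow> nat \<Rightarrow> complex) \<Rightarrow> bool" where
  "hermitian n M \<longleftrightarrow> (\<forall>p<n. \<forall>q<n. M p q = cnj (M q p))"

lemma cinner_cnj: "cnj (cinner n u v) = cinner n v u"
  by (simp add: cinner_def mult.commute)

lemma cinner_self: "cinner n v v = complex_of_real (sqnorm n v)"
  by (simp add: cinner_def sqnorm_def mult.commute flip: complex_norm_square)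

lemma cinner_add_right: "cinner n u (\<lambda>p. v p + w p) = cinner n u v + cinner n u w"
  by (simp add: cinner_def algebra_simps sum.distrib)

lemma cinner_diff_right: "cinner n u (\<lambda>p. v p - w p) = cinner n u v - cinner n u w"
  by (simp add: cinner_def algebra_simps sum_subtractf)

lemma cinner_scale_right: "cinner n u (\<lambda>p. c * v p) = c * cinner n u v"
  by (simp add: cinner_def algebra_simps sum_distrib_left)

lemma cinner_sum_right: "cinner n u (\<lambda>p. \<Sum>j\<in>J. c j * v j p) = (\<Sum>j\<in>J. c j * cinner n u (v j))"
  by (simp add: cinner_def sum_distrib_left sum_distrib_right mult_ac) (rule sum.swap)

lemma cinner_add_left: "cinner n (\<lambda>p. v p + w p) u = cinner n v u + cinner n w u"
  by (simp add: cinner_def algebra_simps sum.distrib)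

lemma cinner_scale_left: "cinner n (\<lambda>p. c * v p) u = cnj c * cinner n v u"
  by (simp add: cinner_def algebra_simps sum_distrib_left)

lemma cinner_cong: "(\<And>p. p < n \<Longrightarrow> v p = w p) \<Longrightarrow> cinner n u v = cinner n u w"
  by (simp add: cinner_def)

lemma sqnorm_nonneg [simp]: "0 \<le> sqnorm n v"
  by (simp add: sqnorm_def sum_nonneg)

lemma sqnorm_eq_0_iff: "sqnorm n v = 0 \<longleftrightarrow> (\<forall>p<n. v p = 0)"
  by (auto simp: sqnorm_def sum_nonneg_eq_0_iff)

lemma sqnorm_scale: "sqnorm n (\<lambda>p. c * v p) = (cmod c)\<^sup>2 * sqnorm n v"
  by (simp add: sqnorm_def norm_mult power_mult_distrib sum_distrib_left)

lemma cmod_le_sqrt_sqnorm: "p < n \<Longrightarrow> cmod (v p) \<le> sqrt (sqnorm n v)"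
  unfolding sqnorm_def by (intro real_le_rsqrt member_le_sum) auto

lemma mat_apply_add: "mat_apply n M (\<lambda>p. v p + w p) = (\<lambda>p. mat_apply n M v p + mat_apply n M w p)"
  by (simp add: mat_apply_def algebra_simps sum.distrib fun_eq_iff)

lemma mat_apply_scale: "mat_apply n M (\<lambda>p. c * v p) = (\<lambda>p. c * mat_apply n M v p)"
  by (simp add: mat_apply_def algebra_simps sum_distrib_left fun_eq_iff)

lemma mat_apply_sum: "mat_apply n M (\<lambda>p. \<Sum>j\<in>J. c j * v j p) = (\<lambda>p. \<Sum>j\<in>J. c j * mat_apply n M (v j) p)"
proof
  fix p
  have "mat_apply n M (\<lambda>p. \<Sum>j\<in>J. c j * v j p) p = (\<Sum>q<n. \<Sum>j\<in>J. c j * (M p q * v j q))"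
    by (simp add: mat_apply_def sum_distrib_left mult_ac)
  also have "\<dots> = (\<Sum>j\<in>J. \<Sum>q<n. c j * (M p q * v j q))" by (rule sum.swap)
  finally show "mat_apply n M (\<lambda>p. \<Sum>j\<in>J. c j * v j p) p = (\<Sum>j\<in>J. c j * mat_apply n M (v j) p)"
    by (simp add: mat_apply_def sum_distrib_left)
qed

lemma hermitian_cinner:
  assumes "hermitian n M"
  shows "cinner n u (mat_apply n M v) = cinner n (mat_apply n M u) v"
proof -
  have "cinner n u (mat_apply n M v) = (\<Sum>p<n. \<Sum>q<n. cnj (u p) * (M p q * v q))"
    by (simp add: cinner_def mat_apply_def sum_distrib_left)
  also have "\<dots> = (\<Sum>p<n. \<Sum>q<n. cnj (M q p * u p) * v q)"
  proof (intro sum.cong refl)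
    fix p q assume "p \<in> {..<n}" "q \<in> {..<n}"
    then have "cnj (M q p) = M p q" using assms unfolding hermitian_def by (metis lessThan_iff)
    then show "cnj (u p) * (M p q * v q) = cnj (M q p * u p) * v q" by simp
  qed
  also have "\<dots> = (\<Sum>q<n. \<Sum>p<n. cnj (M q p * u p) * v q)" by (rule sum.swap)
  also have "\<dots> = cinner n (mat_apply n M u) v"
    by (simp add: cinner_def mat_apply_def sum_distrib_right)
  finally show ?thesis .
qed

section \<open>Eigenvectors as successive Rayleigh maximizers\<close>

lemma quadratic_nonneg_imp_linear_zero:
  fixes b c :: real
  assumes "\<And>t. 0 \<le> 2 * t * b + t\<^sup>2 * c"
  shows "b = 0"
proof (rule ccontr)
  assume b: "b \<noteq> 0"
  \<comment> \<open>With \<open>c < d\<close>, the point \<open>t = - b / d\<close> is so close to 0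
    that the linear term outweighs the quadratic one and the value is negative.\<close>
  define d where "d = \<bar>c\<bar> + 1"
  have d: "d > 0" "c < d" by (auto simp: d_def)
  have "0 \<le> 2 * (- b / d) * b + (- b / d)\<^sup>2 * c" by (rule assms)
  also have "\<dots> = b\<^sup>2 / d * (c / d - 2)" using d by (simp add: field_simps power2_eq_square)
  also have "\<dots> < 0" using b d by (intro mult_pos_neg) (auto simp: field_simps)
  finally show False by simp
qed

text \<open>The orthogonal complement of the eigenvectors already found is invariant under
  \<open>M\<close>. A unit vector maximizing the quadratic form there is an eigenvector, because its
  residual lies in the same complement and is an admissible direction of variation.\<close>

lemma rayleigh_maximizer:
  assumes M: "hermitian n M" and k: "k < n"
    and u: "\<And>j p. j < k \<Longrightarrow> p < n \<Longrightarrow> mat_apply n M (u j) p = complex_of_real (e j) * u j p"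
  obtains v c where "sqnorm n v = 1" "\<And>j. j < k \<Longrightarrow> cinner n (u j) v = 0"
    "\<And>p. p < n \<Longrightarrow> mat_apply n M v p = complex_of_real c * v p"
    "\<And>w. (\<And>j. j < k \<Longrightarrow> cinner n (u j) w = 0) \<Longrightarrow>
       Re (cinner n w (mat_apply n M w)) \<le> c * sqnorm n w"
proof -
  \<comment> \<open>Coordinates from \<open>n\<close> on are pinned to 0, which makes this copy of
    the unit sphere compact among functions on all of \<open>nat\<close>.\<close>
  define S where "S = {v. \<forall>p. v p \<in> (if p < n then cball 0 1 else {0})}
     \<inter> {v. sqnorm n v = 1} \<inter> (\<Inter>j\<in>{..<k}. {v. cinner n (u j) v = 0})"
  define q where "q v = Re (cinner n v (mat_apply n M v))" for v
  have "compact S" unfolding S_def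
    apply (intro compact_Int_closed compact_fun_box closed_INT ballI closed_Collect_eq)
    unfolding sqnorm_def cinner_def
    by (auto intro!: continuous_on_sum continuous_on_power continuous_on_norm continuous_on_mult
        continuous_on_const continuous_on_coordinate)
  moreover have normalize: "(\<lambda>p. if p < n then w p / sqrt (sqnorm n w) else 0) \<in> S"
    if "sqnorm n w \<noteq> 0" "\<And>j. j < k \<Longrightarrow> cinner n (u j) w = 0" for w
  proof -
    let ?v = "\<lambda>p. if p < n then w p / sqrt (sqnorm n w) else 0"
    have s: "sqnorm n w > 0" using that(1) sqnorm_nonneg[of n w] by linarith
    have "sqnorm n ?v = sqnorm n (\<lambda>p. complex_of_real (1 / sqrt (sqnorm n w)) * w p)"
      by (simp add: sqnorm_def)
    also have "\<dots> = 1" unfolding sqnorm_scale using s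
      by (simp add: power_divide norm_divide)
    finally have 1: "sqnorm n ?v = 1" .
    have "cinner n (u j) ?v = 0" if "j < k" for j
    proof -
      have "cinner n (u j) ?v = cinner n (u j) (\<lambda>p. complex_of_real (1 / sqrt (sqnorm n w)) * w p)"
        by (rule cinner_cong) simp
      then show ?thesis unfolding cinner_scale_right using \<open>\<And>j. j < k \<Longrightarrow> cinner n (u j) w = 0\<close>[OF that] by simp
    qed
    moreover have "cmod (?v p) \<le> 1" if "p < n" for p
      using cmod_le_sqrt_sqnorm[OF that, of ?v] unfolding 1 by simp
    ultimately show ?thesis using 1 by (auto simp: S_def)
  qed
  moreover have "S \<noteq> {}"
  proof -
    obtain x where x: "\<exists>p<n. x p \<noteq> 0" "\<And>j. j < k \<Longrightarrow> (\<Sum>p<n. cnj (u j p) * x p) = 0"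
      using underdetermined_system[OF k, of "\<lambda>j p. cnj (u j p)"] by metis
    then show ?thesis using normalize[of x] by (auto simp: sqnorm_eq_0_iff cinner_def)
  qed
  moreover have "continuous_on S q"
    unfolding q_def cinner_def mat_apply_def
    by (intro continuous_on_Re continuous_on_sum continuous_on_mult continuous_on_cnj
        continuous_on_const continuous_on_coordinate)
  ultimately obtain v where v: "v \<in> S" "\<And>w. w \<in> S \<Longrightarrow> q w \<le> q v"
    using continuous_attains_sup[of S q] by blast
  have v1: "sqnorm n v = 1" and vo: "\<And>j. j < k \<Longrightarrow> cinner n (u j) v = 0"
    using v(1) by (auto simp: S_def)
  have bound: "q w \<le> q v * sqnorm n w" if w: "\<And>j. j < k \<Longrightarrow> cinner n (u j) w = 0" for w
  proof (cases "sqnorm n w = 0")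
    case True
    then have "q w = 0" by (simp add: q_def cinner_def sqnorm_eq_0_iff)
    with True show ?thesis by simp
  next
    case False
    then have s: "sqnorm n w > 0" using sqnorm_nonneg[of n w] by linarith
    let ?c = "complex_of_real (1 / sqrt (sqnorm n w))"
    let ?v = "\<lambda>p. if p < n then w p / sqrt (sqnorm n w) else 0"
    have "q ?v = q (\<lambda>p. ?c * w p)"
      unfolding q_def cinner_def mat_apply_def by (intro arg_cong[where f=Re] sum.cong) auto
    also have "\<dots> = q w / sqnorm n w"
      unfolding q_def mat_apply_scale cinner_scale_right cinner_scale_left using s
      by (simp flip: of_real_mult mult.assoc)
    finally have "q w / sqnorm n w \<le> q v" using v(2)[OF normalize[OF False w]] by simp
    then show ?thesis using s by (simp add: field_simps)
  qed
  \<comment> \<open>The residual of the eigenvalue equation at the candidate value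
    \<open>q v\<close>.\<close>
  define w where "w p = mat_apply n M v p - complex_of_real (q v) * v p" for p
  have wo: "cinner n (u j) w = 0" if "j < k" for j
  proof -
    have "cinner n (u j) (mat_apply n M v) = cnj (cinner n v (mat_apply n M (u j)))"
      unfolding hermitian_cinner[OF M] cinner_cnj ..
    also have "cinner n v (mat_apply n M (u j)) = cinner n v (\<lambda>p. complex_of_real (e j) * u j p)"
      using u that by (intro cinner_cong) auto
    also have "\<dots> = 0" using cinner_cnj[of n "u j" v] vo[OF that] by (simp add: cinner_scale_right)
    finally show ?thesis unfolding w_def using vo[OF that]
      by (simp add: cinner_diff_right cinner_scale_right)
  qed
  \<comment> \<open>First-order optimality along \<open>v + t w\<close>: by \<open>bound\<close>,
    \<open>q v * sqnorm n ?z - q ?z\<close> is nonnegative for all real \<open>t\<close>. Its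
    constant term cancels and its linear coefficient is \<open>- 2 * sqnorm n w\<close>.\<close>
  have "sqnorm n w = 0"
  proof (rule quadratic_nonneg_imp_linear_zero[of "- sqnorm n w" "q v * sqnorm n w - q w", THEN neg_equal_0_iff_equal[THEN iffD1]])
    fix t :: real
    let ?z = "\<lambda>p. v p + complex_of_real t * w p"
    have cw: "cinner n w (mat_apply n M v) = complex_of_real (sqnorm n w) + q v * cinner n w v"
    proof -
      have "cinner n w w = cinner n w (\<lambda>p. mat_apply n M v p - complex_of_real (q v) * v p)"
        by (intro cinner_cong) (simp add: w_def)
      then have "cinner n w w = cinner n w (mat_apply n M v) - q v * cinner n w v"
        by (simp add: cinner_diff_right cinner_scale_right)
      then show ?thesis by (simp add: cinner_self)
    qed
    have "q ?z \<le> q v * sqnorm n ?z"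
      by (rule bound) (simp add: cinner_add_right cinner_scale_right vo wo)
    moreover have "q ?z = q v + 2 * t * Re (cinner n w (mat_apply n M v)) + t\<^sup>2 * q w"
    proof -
      have "cinner n v (mat_apply n M w) = cnj (cinner n w (mat_apply n M v))"
        unfolding hermitian_cinner[OF M, of v w] by (simp add: cinner_cnj)
      then show ?thesis
      by (simp add: q_def mat_apply_add mat_apply_scale cinner_add_right cinner_add_left
            cinner_scale_left cinner_scale_right power2_eq_square algebra_simps)
    qed
    moreover have "sqnorm n ?z = 1 + 2 * t * Re (cinner n w v) + t\<^sup>2 * sqnorm n w"
    proof -
      have "complex_of_real (sqnorm n ?z) = 1 + t * (cinner n w v + cnj (cinner n w v)) + t\<^sup>2 * sqnorm n w"
        unfolding cinner_self[symmetric] cinner_cnj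
        by (simp add: cinner_add_right cinner_add_left cinner_scale_left cinner_scale_right
          power2_eq_square algebra_simps) (simp add: cinner_self v1)
      then have "Re (complex_of_real (sqnorm n ?z)) = 1 + t * (2 * Re (cinner n w v)) + t\<^sup>2 * sqnorm n w"
        by (simp only: complex_add_cnj) simp
      then show ?thesis by simp
    qed
    ultimately show "0 \<le> 2 * t * (- sqnorm n w) + t\<^sup>2 * (q v * sqnorm n w - q w)"
      unfolding cw by (simp add: algebra_simps)
  qed
  then have "mat_apply n M v p = complex_of_real (q v) * v p" if "p < n" for p
    using that by (simp add: sqnorm_eq_0_iff w_def)
  with that[of v "q v"] v1 vo bound show ?thesis by (simp add: q_def)
qed

text \<open>The last conjunct is the Courant--Fischer upper bound; it also forces \<open>e\<close> to be nonincreasing.\<close>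

definition spectral_system ::
    "nat \<Rightarrow> nat \<Rightarrow> (nat \<Rightarrow> nat \<Rightarrow> complex) \<Rightarrow> (nat \<Rightarrow> nat \<Rightarrow> complex) \<Rightarrow> (nat \<Rightarrow> real) \<Rightarrow> bool" where
  "spectral_system k n M u e \<longleftrightarrow>
     (\<forall>i<k. \<forall>j<k. cinner n (u i) (u j) = (if i = j then 1 else 0)) \<and>
     (\<forall>i<k. \<forall>p<n. mat_apply n M (u i) p = complex_of_real (e i) * u i p) \<and>
     (\<forall>i<k. \<forall>w. (\<forall>j<i. cinner n (u j) w = 0) \<longrightarrow>
        Re (cinner n w (mat_apply n M w)) \<le> e i * sqnorm n w)"

text \<open>Each new maximizer extends the system by one; its maximality is the variational bound
  required for the new index.\<close>

lemma spectral_system_exists: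
  assumes M: "hermitian n M" and "k \<le> n"
  shows "\<exists>u e. spectral_system k n M u e"
  using \<open>k \<le> n\<close>
proof (induction k)
  case 0
  show ?case by (simp add: spectral_system_def)
next
  case (Suc k)
  then obtain u e where ue: "spectral_system k n M u e" by auto
  then have eig: "\<And>j p. j < k \<Longrightarrow> p < n \<Longrightarrow> mat_apply n M (u j) p = complex_of_real (e j) * u j p"
    by (auto simp: spectral_system_def)
  from Suc.prems have kn: "k < n" by simp
  show ?case
  proof (rule rayleigh_maximizer[OF M kn eig])
    fix v c assume v: "sqnorm n v = 1" "\<And>j. j < k \<Longrightarrow> cinner n (u j) v = 0"
      "\<And>p. p < n \<Longrightarrow> mat_apply n M v p = complex_of_real c * v p"
      "\<And>w. (\<And>j. j < k \<Longrightarrow> cinner n (u j) w = 0) \<Longrightarrow>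
         Re (cinner n w (mat_apply n M w)) \<le> c * sqnorm n w"
    have v': "cinner n v (u j) = 0" if "j < k" for j
      using v(2)[OF that] cinner_cnj[of n "u j" v] by simp
    have "spectral_system (Suc k) n M (u(k := v)) (e(k := c))"
      using ue v v' unfolding spectral_system_def
      by (auto simp: less_Suc_eq cinner_self)
    then show ?thesis by blast
  qed
qed

lemma spectral_system_rayleigh:
  assumes "spectral_system k n M u e" "j < k"
  shows "Re (cinner n (u j) (mat_apply n M (u j))) = e j"
proof -
  have "cinner n (u j) (mat_apply n M (u j)) = cinner n (u j) (\<lambda>p. complex_of_real (e j) * u j p)"
    using assms by (intro cinner_cong) (simp add: spectral_system_def)
  then show ?thesis using assms by (simp add: cinner_scale_right spectral_system_def)
qed

text \<open>\<open>u j\<close> is orthogonal to all \<open>u l\<close> with \<open>l < i\<close>, so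
  it is a competitor in the variational bound for \<open>e i\<close>, and its own quotient is
  \<open>e j\<close>.\<close>

lemma spectral_system_antimono:
  assumes "spectral_system k n M u e" "i \<le> j" "j < k"
  shows "e j \<le> e i"
proof -
  have "cinner n (u j) (u j) = 1" using assms by (simp add: spectral_system_def)
  then have "sqnorm n (u j) = 1" by (simp add: cinner_self)
  moreover have "Re (cinner n (u j) (mat_apply n M (u j))) \<le> e i * sqnorm n (u j)"
    using assms by (simp add: spectral_system_def)
  ultimately show ?thesis using spectral_system_rayleigh[OF assms(1,3)] by simp
qed

text \<open>The lower half of Courant-Fischer: on the span of the first \<open>i + 1\<close>
  eigenvectors the Rayleigh quotient is a weighted mean of \<open>e 0\<close>, ...,
  \<open>e i\<close>, of which \<open>e i\<close> is the smallest.\<close>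

lemma spectral_system_combination:
  assumes "spectral_system k n M u e" "i < k"
  defines "w c \<equiv> \<lambda>p. \<Sum>j<Suc i. c j * u j p"
  shows "sqnorm n (w c) = (\<Sum>j<Suc i. (cmod (c j))\<^sup>2)"
    and "e i * sqnorm n (w c) \<le> Re (cinner n (w c) (mat_apply n M (w c)))"
proof -
  have uw: "cinner n (w c) (u j) = cnj (c j)" if "j < Suc i" for j
  proof -
    have "cinner n (u j) (w c) = (\<Sum>l<Suc i. c l * (if j = l then 1 else 0))"
      unfolding w_def cinner_sum_right using assms that
      by (intro sum.cong) (auto simp: spectral_system_def)
    also have "\<dots> = c j" using that by (simp add: if_distrib cong: if_cong)
    finally show ?thesis by (metis cinner_cnj)
  qed
  have "complex_of_real (sqnorm n (w c)) = (\<Sum>j<Suc i. c j * cinner n (w c) (u j))"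
    unfolding cinner_self[symmetric] by (subst (2) w_def) (rule cinner_sum_right)
  also have "\<dots> = complex_of_real (\<Sum>j<Suc i. (cmod (c j))\<^sup>2)"
    unfolding of_real_sum by (intro sum.cong refl) (simp add: uw complex_norm_square mult_ac del: of_real_power sum.lessThan_Suc)
  finally show *: "sqnorm n (w c) = (\<Sum>j<Suc i. (cmod (c j))\<^sup>2)" using of_real_eq_iff by blast
  have "cinner n (w c) (mat_apply n M (w c)) =
      cinner n (w c) (\<lambda>p. \<Sum>j<Suc i. (c j * complex_of_real (e j)) * u j p)"
  proof (rule cinner_cong)
    fix p assume "p < n"
    then show "mat_apply n M (w c) p = (\<Sum>j<Suc i. (c j * complex_of_real (e j)) * u j p)"
      unfolding w_def mat_apply_sum using assms(1,2)
      by (intro sum.cong) (auto simp: spectral_system_def)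
  qed
  also have "\<dots> = (\<Sum>j<Suc i. (c j * complex_of_real (e j)) * cinner n (w c) (u j))"
    by (rule cinner_sum_right)
  also have "\<dots> = complex_of_real (\<Sum>j<Suc i. e j * (cmod (c j))\<^sup>2)"
    unfolding of_real_sum of_real_mult
    by (intro sum.cong refl) (simp add: uw complex_norm_square mult_ac del: of_real_power sum.lessThan_Suc)
  finally have "Re (cinner n (w c) (mat_apply n M (w c))) = (\<Sum>j<Suc i. e j * (cmod (c j))\<^sup>2)"
    by (simp del: sum.lessThan_Suc)
  moreover have "e i * sqnorm n (w c) \<le> (\<Sum>j<Suc i. e j * (cmod (c j))\<^sup>2)"
    unfolding * sum_distrib_left
    using spectral_system_antimono[OF assms(1) _ assms(2)]
    by (intro sum_mono mult_right_mono) auto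
  ultimately show "e i * sqnorm n (w c) \<le> Re (cinner n (w c) (mat_apply n M (w c)))" by simp
qed

section \<open>Identifying the spectral values with the singular values of
  \<open>sing_val\<close>\<close>

text \<open>A full orthonormal eigenbasis is a unitary \<open>U\<close> with inverse
  \<open>V\<close>, its conjugate transpose, and \<open>U\<close> makes the matrix similar to a
  diagonal one.\<close>

lemma spectral_system_char_poly:
  assumes "spectral_system n n M u e"
  shows "char_poly (mat n n (\<lambda>(p, q). M p q)) = (\<Prod>a\<leftarrow>map (\<lambda>i. complex_of_real (e i)) [0..<n]. [:- a, 1:])"
proof -
  define Mm U V D where "Mm = mat n n (\<lambda>(p, q). M p q)" and "U = mat n n (\<lambda>(p, j). u j p)"
    and "V = mat n n (\<lambda>(j, p). cnj (u j p))"
    and "D = mat n n (\<lambda>(i, j). if i = j then complex_of_real (e i) else 0)"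
  note defs = Mm_def U_def V_def D_def
  have carr: "Mm \<in> carrier_mat n n" "U \<in> carrier_mat n n" "V \<in> carrier_mat n n" "D \<in> carrier_mat n n"
    by (simp_all add: defs)
  have VU: "V * U = 1\<^sub>m n"
    using assms by (intro eq_matI)
      (auto simp: defs scalar_prod_def spectral_system_def cinner_def lessThan_atLeast0)
  then have UV: "U * V = 1\<^sub>m n" using carr mat_mult_left_right_inverse by blast
  have "Mm * U = U * D"
  proof (rule eq_matI)
    fix p j assume pj: "p < dim_row (U * D)" "j < dim_col (U * D)"
    then have "(U * D) $$ (p, j) = u j p * complex_of_real (e j)"
      by (simp add: defs scalar_prod_def if_distrib[of "\<lambda>x. _ * x"] sum.delta cong: if_cong)
    moreover have "(Mm * U) $$ (p, j) = mat_apply n M (u j) p"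
      using pj by (simp add: defs scalar_prod_def mat_apply_def lessThan_atLeast0)
    ultimately show "(Mm * U) $$ (p, j) = (U * D) $$ (p, j)"
      using assms pj by (simp add: defs spectral_system_def)
  qed (simp_all add: defs)
  then have "U * D * V = Mm * (U * V)" using carr by (metis assoc_mult_mat)
  then have "Mm = U * D * V" using UV carr by simp
  then have "similar_mat Mm D" using carr VU UV
    unfolding similar_mat_def similar_mat_wit_def Let_def by (intro exI[of _ U] exI[of _ V]) auto
  then have "char_poly Mm = char_poly D" by (rule char_poly_similar)
  also have "\<dots> = (\<Prod>a\<leftarrow>diag_mat D. [:- a, 1:])"
    by (rule char_poly_upper_triangular[OF carr(4)]) (auto simp: defs)
  also have "diag_mat D = map (\<lambda>i. complex_of_real (e i)) [0..<n]"
    by (simp add: diag_mat_def D_def)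
  finally show ?thesis by (simp add: Mm_def)
qed

lemma mset_eqI_linear_factors:
  assumes "(\<Prod>a\<leftarrow>as. [:- a, 1:]) = (\<Prod>a\<leftarrow>bs. [:- a, 1::'a::idom:])"
  shows "mset as = mset bs"
proof -
  have "proots (\<Prod>a\<leftarrow>cs. [:- a, 1::'a:]) = mset cs" for cs
  proof (induction cs)
    case (Cons c cs)
    have "(\<Prod>a\<leftarrow>cs. [:- a, 1::'a:]) \<noteq> 0" by (auto simp: prod_list_zero_iff)
    with Cons show ?case by (simp only: list.map prod_list.Cons) (subst proots_mult, auto)
  qed simp
  with assms show ?thesis by metis
qed

text \<open>The entries of \<open>A^H A\<close>, in the form in which they occur inside
  \<open>sing_val\<close>.\<close>

definition gram :: "nat \<Rightarrow> (nat \<Rightarrow> nat \<Rightarrow> complex) \<Rightarrow> nat \<Rightarrow> nat \<Rightarrow> complex" where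
  "gram m A p q = (\<Sum>l<m. cnj (A l p) * A l q)"

lemma hermitian_gram: "hermitian n (gram m A)"
  by (simp add: hermitian_def gram_def mult.commute)

lemma cinner_gram: "cinner n v (mat_apply n (gram m A) v) = complex_of_real (sqnorm m (mat_apply n A v))"
proof -
  have "cinner n v (mat_apply n (gram m A) v) = (\<Sum>p<n. \<Sum>q<n. \<Sum>l<m. cnj (A l p * v p) * (A l q * v q))"
    by (simp add: cinner_def mat_apply_def gram_def sum_distrib_left sum_distrib_right mult_ac)
  also have "\<dots> = (\<Sum>p<n. \<Sum>l<m. \<Sum>q<n. cnj (A l p * v p) * (A l q * v q))"
    by (intro sum.cong refl sum.swap)
  also have "\<dots> = (\<Sum>l<m. \<Sum>p<n. \<Sum>q<n. cnj (A l p * v p) * (A l q * v q))" by (rule sum.swap)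
  also have "\<dots> = cinner m (mat_apply n A v) (mat_apply n A v)"
    by (simp add: cinner_def mat_apply_def sum_product)
  finally show ?thesis by (simp add: cinner_self)
qed

text \<open>\<open>eigvals_list\<close> is an arbitrary choice of ordering, but the characteristic
  polynomial determines its multiset, and sorting removes the remaining freedom.\<close>

lemma spectral_system_gram_sing_val:
  assumes S: "spectral_system n n (gram m A) u e" and i: "i < n"
  shows "0 \<le> e i" "sing_val m n A i = sqrt (e i)"
proof -
  show "0 \<le> e i" using spectral_system_rayleigh[OF S i] sqnorm_nonneg[of m "mat_apply n A (u i)"]
    by (simp add: cinner_gram del: sqnorm_nonneg)
  define G where "G = mat n n (\<lambda>(p, q). \<Sum>l<m. cnj (A l p) * A l q)"
  have G: "G = mat n n (\<lambda>(p, q). gram m A p q)" by (simp add: G_def gram_def)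
  have "char_poly G = (\<Prod>a\<leftarrow>eigvals_list G. [:- a, 1:]) \<and> length (eigvals_list G) = dim_row G"
    unfolding eigvals_list_def by (rule someI_ex, rule char_poly_factorized) (simp add: G)
  then have "mset (eigvals_list G) = mset (map (\<lambda>i. complex_of_real (e i)) [0..<n])"
    using spectral_system_char_poly[OF S] by (intro mset_eqI_linear_factors) (simp add: G)
  then have "mset (map (\<lambda>a. sqrt (Re a)) (eigvals_list G))
      = mset (map (\<lambda>a. sqrt (Re a)) (map (\<lambda>i. complex_of_real (e i)) [0..<n]))"
    by (metis mset_map)
  also have "\<dots> = mset (rev (map (\<lambda>i. sqrt (e i)) [0..<n]))" by (simp add: comp_def)
  finally have ms: "mset (map (\<lambda>a. sqrt (Re a)) (eigvals_list G)) = mset (rev (map (\<lambda>i. sqrt (e i)) [0..<n]))" .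
  \<comment> \<open>The spectral values come out nonincreasing, so reversing them yields the
    ascending list that \<open>sort\<close> must return.\<close>
  have "sorted (rev (map (\<lambda>i. sqrt (e i)) [0..<n]))"
    unfolding sorted_rev_iff_nth_mono using spectral_system_antimono[OF S] by auto
  with ms have "sort (map (\<lambda>a. sqrt (Re a)) (eigvals_list G)) = rev (map (\<lambda>i. sqrt (e i)) [0..<n])"
    by (intro properties_for_sort) auto
  then show "sing_val m n A i = sqrt (e i)"
    unfolding sing_val_def G_def[symmetric] using i by simp
qed

section \<open>Perturbation of singular values\<close>

lemma sqrt_sqnorm: "sqrt (sqnorm n v) = L2_set (\<lambda>p. cmod (v p)) {..<n}"
  by (simp add: sqnorm_def L2_set_def)

lemma sqrt_sqnorm_triangle: "sqrt (sqnorm n (\<lambda>p. v p + w p)) \<le> sqrt (sqnorm n v) + sqrt (sqnorm n w)"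
proof -
  have "sqrt (sqnorm n (\<lambda>p. v p + w p)) \<le> L2_set (\<lambda>p. cmod (v p) + cmod (w p)) {..<n}"
    unfolding sqrt_sqnorm by (intro L2_set_mono norm_triangle_ineq) auto
  also have "\<dots> \<le> sqrt (sqnorm n v) + sqrt (sqnorm n w)"
    unfolding sqrt_sqnorm by (rule L2_set_triangle_ineq)
  finally show ?thesis .
qed

text \<open>A crude operator norm estimate: the Euclidean norm of the image is at most the sum of
  its \<open>m\<close> moduli, each a sum of \<open>n\<close> products.\<close>

lemma sqrt_sqnorm_mat_apply_le:
  assumes "\<And>l p. l < m \<Longrightarrow> p < n \<Longrightarrow> cmod (A l p) \<le> d"
  shows "sqrt (sqnorm m (mat_apply n A v)) \<le> real m * real n * d * sqrt (sqnorm n v)"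
proof -
  have "sqrt (sqnorm m (mat_apply n A v)) \<le> (\<Sum>l<m. cmod (mat_apply n A v l))"
    unfolding sqrt_sqnorm by (rule L2_set_le_sum) simp
  also have "\<dots> \<le> (\<Sum>l<m. \<Sum>p<n. d * sqrt (sqnorm n v))"
    unfolding mat_apply_def
  proof (intro sum_mono order_trans[OF norm_sum])
    fix l p assume "l \<in> {..<m}" "p \<in> {..<n}"
    then show "cmod (A l p * v p) \<le> d * sqrt (sqnorm n v)"
      unfolding norm_mult using assms[of l p] cmod_le_sqrt_sqnorm[of p n v]
      by (intro mult_mono) (auto intro: order_trans[OF norm_ge_zero])
  qed
  finally show ?thesis by (simp add: mult_ac)
qed

text \<open>A single nonzero vector \<open>v\<close> can be found that \<open>A\<close> stretches by
  at least its \<open>i\<close>-th singular value and \<open>B\<close> by at most its own;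
  \<open>A v\<close> and \<open>B v\<close> differ by at most \<open>m n d\<close> times the norm of
  \<open>v\<close>.\<close>

lemma sing_val_diff_le:
  assumes i: "i < n" and AB: "\<And>l p. l < m \<Longrightarrow> p < n \<Longrightarrow> cmod (A l p - B l p) \<le> d"
  shows "sing_val m n A i - sing_val m n B i \<le> real m * real n * d"
proof -
  obtain u a where u: "spectral_system n n (gram m A) u a"
    using spectral_system_exists[OF hermitian_gram] by blast
  obtain w b where w: "spectral_system n n (gram m B) w b"
    using spectral_system_exists[OF hermitian_gram] by blast
  \<comment> \<open>The span of the top \<open>i + 1\<close> vectors for \<open>A\<close> meets the orthogonal complement of the top \<open>i\<close> for \<open>B\<close>.\<close>
  obtain c where c: "\<exists>p<Suc i. c p \<noteq> 0"
      "\<And>j. j < i \<Longrightarrow> (\<Sum>l<Suc i. cinner n (w j) (u l) * c l) = 0"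
    using underdetermined_system[of i "Suc i" "\<lambda>j l. cinner n (w j) (u l)"] by auto
  define v where "v = (\<lambda>p. \<Sum>l<Suc i. c l * u l p)"
  have "sqnorm n v = (\<Sum>j<Suc i. (cmod (c j))\<^sup>2)"
    unfolding v_def by (rule spectral_system_combination(1)[OF u i])
  then have "sqnorm n v \<noteq> 0" using c(1) by (auto simp: sum_nonneg_eq_0_iff simp del: sum.lessThan_Suc)
  then have vpos: "sqrt (sqnorm n v) > 0" using sqnorm_nonneg[of n v] by (simp add: less_le)
  have "a i * sqnorm n v \<le> sqnorm m (mat_apply n A v)"
    using spectral_system_combination(2)[OF u i, of c] unfolding v_def cinner_gram by (simp del: sum.lessThan_Suc)
  then have 1: "sing_val m n A i * sqrt (sqnorm n v) \<le> sqrt (sqnorm m (mat_apply n A v))"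
    unfolding spectral_system_gram_sing_val(2)[OF u i] by (simp flip: real_sqrt_mult)
  have "cinner n (w j) v = 0" if "j < i" for j
    using c(2)[OF that] unfolding v_def cinner_sum_right by (simp add: mult.commute)
  then have "Re (cinner n v (mat_apply n (gram m B) v)) \<le> b i * sqnorm n v"
    using w i unfolding spectral_system_def by auto
  then have 2: "sqrt (sqnorm m (mat_apply n B v)) \<le> sing_val m n B i * sqrt (sqnorm n v)"
    unfolding spectral_system_gram_sing_val(2)[OF w i] by (simp add: cinner_gram flip: real_sqrt_mult)
  have "mat_apply n A v = (\<lambda>p. mat_apply n B v p + mat_apply n (\<lambda>l p. A l p - B l p) v p)"
    by (simp add: mat_apply_def fun_eq_iff algebra_simps flip: sum.distrib)
  then have "sqrt (sqnorm m (mat_apply n A v)) \<le>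
      sqrt (sqnorm m (mat_apply n B v)) + sqrt (sqnorm m (mat_apply n (\<lambda>l p. A l p - B l p) v))"
    using sqrt_sqnorm_triangle by presburger
  also have "\<dots> \<le> sing_val m n B i * sqrt (sqnorm n v) + real m * real n * d * sqrt (sqnorm n v)"
    by (intro add_mono 2 sqrt_sqnorm_mat_apply_le AB)
  finally have "sing_val m n A i * sqrt (sqnorm n v) \<le> (sing_val m n B i + real m * real n * d) * sqrt (sqnorm n v)"
    using 1 by (simp add: algebra_simps)
  then show ?thesis using vpos by (simp only: mult_le_cancel_right) simp
qed

lemma sing_val_nonneg: "i < n \<Longrightarrow> 0 \<le> sing_val m n A i"
  using spectral_system_exists[OF hermitian_gram order_refl, of n m A]
    spectral_system_gram_sing_val[of n m A _ _ i] by auto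

lemma sing_val_lipschitz:
  assumes i: "i < n" and AB: "\<And>l p. l < m \<Longrightarrow> p < n \<Longrightarrow> cmod (A l p - B l p) \<le> d"
  shows "\<bar>sing_val m n A i - sing_val m n B i\<bar> \<le> real m * real n * d"
  using sing_val_diff_le[OF i, of m A B d] sing_val_diff_le[OF i, of m B A d] AB
  by (simp add: norm_minus_commute abs_le_iff)

section \<open>The tensor space\<close>

lemma t_inner_conv_sum:
  "t_inner n1 n2 n3 X Y = (\<Sum>(i, j, k)\<in>{..<n1} \<times> {..<n2} \<times> {..<n3}. X i j k * Y i j k)"
  by (simp add: t_inner_def sum.cartesian_product)

lemma t_inner_commute: "t_inner n1 n2 n3 X Y = t_inner n1 n2 n3 Y X"
  by (simp add: t_inner_def mult.commute)

lemma t_inner_diff_left: "t_inner n1 n2 n3 (t_diff X Y) Z = t_inner n1 n2 n3 X Z - t_inner n1 n2 n3 Y Z"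
  by (simp add: t_inner_def t_diff_def left_diff_distrib sum_subtractf)

lemma t_inner_diff_right: "t_inner n1 n2 n3 Z (t_diff X Y) = t_inner n1 n2 n3 Z X - t_inner n1 n2 n3 Z Y"
  by (simp add: t_inner_commute[of _ _ _ Z] t_inner_diff_left)

lemma t_inner_extrap_left:
  "t_inner n1 n2 n3 (t_extrap X c W) Z = t_inner n1 n2 n3 X Z + c * t_inner n1 n2 n3 (t_diff X W) Z"
  by (simp add: t_inner_def t_extrap_def t_diff_def distrib_right sum.distrib sum_distrib_left mult.assoc)

lemma t_inner_extrap_right:
  "t_inner n1 n2 n3 Z (t_extrap X c W) = t_inner n1 n2 n3 Z X + c * t_inner n1 n2 n3 Z (t_diff X W)"
  by (simp add: t_inner_commute[of _ _ _ Z] t_inner_extrap_left)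

lemma t_norm_conv_L2_set:
  "t_norm n1 n2 n3 X = L2_set (\<lambda>(i, j, k). X i j k) ({..<n1} \<times> {..<n2} \<times> {..<n3})"
  by (simp add: t_norm_def t_inner_conv_sum L2_set_def power2_eq_square case_prod_unfold)

lemma t_norm_nonneg [simp]: "0 \<le> t_norm n1 n2 n3 X"
  by (simp add: t_norm_conv_L2_set)

lemma t_norm_power2: "(t_norm n1 n2 n3 X)\<^sup>2 = t_inner n1 n2 n3 X X"
proof -
  have "0 \<le> t_inner n1 n2 n3 X X" unfolding t_inner_def by (intro sum_nonneg) simp
  then show ?thesis by (simp add: t_norm_def)
qed

lemma t_inner_abs_le: "\<bar>t_inner n1 n2 n3 X Y\<bar> \<le> t_norm n1 n2 n3 X * t_norm n1 n2 n3 Y"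
proof -
  let ?I = "{..<n1} \<times> {..<n2} \<times> {..<n3}"
  have "\<bar>t_inner n1 n2 n3 X Y\<bar> \<le> (\<Sum>p\<in>?I. \<bar>(\<lambda>(i, j, k). X i j k) p\<bar> * \<bar>(\<lambda>(i, j, k). Y i j k) p\<bar>)"
    unfolding t_inner_conv_sum by (rule order_trans[OF sum_abs]) (simp add: case_prod_unfold abs_mult)
  also have "\<dots> \<le> t_norm n1 n2 n3 X * t_norm n1 n2 n3 Y"
    unfolding t_norm_conv_L2_set by (rule L2_set_mult_ineq)
  finally show ?thesis .
qed

lemma abs_entry_le_t_norm:
  assumes "i < n1" "j < n2" "k < n3"
  shows "\<bar>X i j k\<bar> \<le> t_norm n1 n2 n3 X"
proof -
  have "(\<lambda>(i, j, k). (X i j k)\<^sup>2) (i, j, k) \<le>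
      (\<Sum>p\<in>{..<n1} \<times> {..<n2} \<times> {..<n3}. (\<lambda>(i, j, k). (X i j k)\<^sup>2) p)"
    using assms by (intro member_le_sum) auto
  then have "(X i j k)\<^sup>2 \<le> t_inner n1 n2 n3 X X"
    by (simp add: t_inner_conv_sum power2_eq_square case_prod_unfold)
  then show ?thesis unfolding t_norm_def by (rule real_le_rsqrt[of "\<bar>X i j k\<bar>", unfolded power2_abs])
qed

lemma t_norm_scale: "t_norm n1 n2 n3 (\<lambda>i j k. c * X i j k) = \<bar>c\<bar> * t_norm n1 n2 n3 X"
proof -
  have "t_inner n1 n2 n3 (\<lambda>i j k. c * X i j k) (\<lambda>i j k. c * X i j k) = c\<^sup>2 * t_inner n1 n2 n3 X X"
    by (simp add: t_inner_def sum_distrib_left power2_eq_square mult_ac)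
  then show ?thesis by (simp add: t_norm_def real_sqrt_mult)
qed

lemma t_inner_scale_right: "t_inner n1 n2 n3 Y (\<lambda>i j k. c * X i j k) = c * t_inner n1 n2 n3 Y X"
  by (simp add: t_inner_def sum_distrib_left mult_ac)

lemma tensor_operations_closed:
  assumes "X \<in> tensors n1 n2 n3" "Y \<in> tensors n1 n2 n3"
  shows "t_diff X Y \<in> tensors n1 n2 n3" "t_extrap X c Y \<in> tensors n1 n2 n3"
  using assms by (auto simp: tensors_def t_diff_def t_extrap_def)

lemma tendsto_t_inner:
  assumes "(U \<longlongrightarrow> u) F" "(V \<longlongrightarrow> v) F"
  shows "((\<lambda>x. t_inner n1 n2 n3 (U x) (V x)) \<longlongrightarrow> t_inner n1 n2 n3 u v) F"
  using assms unfolding t_inner_def tendsto_fun_iff by (intro tendsto_sum tendsto_mult) auto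

lemma tendsto_t_norm:
  assumes "(U \<longlongrightarrow> u) F"
  shows "((\<lambda>x. t_norm n1 n2 n3 (U x)) \<longlongrightarrow> t_norm n1 n2 n3 u) F"
  unfolding t_norm_def by (intro tendsto_real_sqrt tendsto_t_inner assms)

lemma tendsto_t_diff:
  assumes "(U \<longlongrightarrow> u) F" "(V \<longlongrightarrow> v) F"
  shows "((\<lambda>x. t_diff (U x) (V x)) \<longlongrightarrow> t_diff u v) F"
  using assms unfolding t_diff_def tendsto_fun_iff by (intro allI tendsto_diff) auto

lemma t_norm_diff_self: "t_norm n1 n2 n3 (t_diff X X) = 0"
  by (simp add: t_norm_def t_inner_def t_diff_def)

lemma tendsto_t_norm_diff_zero:
  assumes "(U \<longlongrightarrow> u) F"
  shows "((\<lambda>x. t_norm n1 n2 n3 (t_diff (U x) u)) \<longlongrightarrow> 0) F"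
  using tendsto_t_norm[OF tendsto_t_diff[OF assms tendsto_const[of u]], of n1 n2 n3]
  by (simp add: t_norm_diff_self)

text \<open>Inside the box each entry is dominated by the norm; outside, both sides are constantly
  zero. Hence norm convergence gives the convergence of functions used for limits of
  tensors.\<close>

lemma tendsto_tensorI:
  assumes "\<And>x. U x \<in> tensors n1 n2 n3" "u \<in> tensors n1 n2 n3"
    and "((\<lambda>x. t_norm n1 n2 n3 (t_diff (U x) u)) \<longlongrightarrow> 0) F"
  shows "(U \<longlongrightarrow> u) F"
  unfolding tendsto_fun_iff
proof (intro allI)
  fix i j k
  show "((\<lambda>x. U x i j k) \<longlongrightarrow> u i j k) F"
  proof (cases "i < n1 \<and> j < n2 \<and> k < n3")
    case True
    have "((\<lambda>x. U x i j k - u i j k) \<longlongrightarrow> 0) F"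
      using abs_entry_le_t_norm[of i n1 j n2 k n3 "t_diff (U _) u"] True
      by (intro Lim_null_comparison[OF always_eventually assms(3)]) (simp add: t_diff_def)
    then show ?thesis by (simp add: LIM_zero_iff)
  next
    case False
    then have "U x i j k = 0" "u i j k = 0" for x using assms(1,2) by (auto simp: tensors_def)
    then show ?thesis by simp
  qed
qed

lemma tensors_limit:
  assumes "F \<noteq> bot" "(U \<longlongrightarrow> u) F" "\<And>x. U x \<in> tensors n1 n2 n3"
  shows "u \<in> tensors n1 n2 n3"
proof -
  have "u i j k = 0" if "\<not> (i < n1 \<and> j < n2 \<and> k < n3)" for i j k
  proof (rule tendsto_unique[OF assms(1)])
    show "((\<lambda>x. U x i j k) \<longlongrightarrow> u i j k) F" using assms(2) by (simp add: tendsto_fun_iff)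
    show "((\<lambda>x. U x i j k) \<longlongrightarrow> 0) F" using assms(3) that by (simp add: tensors_def)
  qed
  then show ?thesis by (simp add: tensors_def)
qed

lemma bounded_tensors_convergent_subseq:
  fixes U :: "nat \<Rightarrow> tensor"
  assumes "\<And>t. U t \<in> tensors n1 n2 n3" "\<And>t. t_norm n1 n2 n3 (U t) \<le> B"
  obtains u s where "strict_mono s" "(\<lambda>l. U (s l)) \<longlonglongrightarrow> u"
proof -
  \<comment> \<open>Three nested boxes, one per index. With \<open>max B 0\<close> the interval
    visibly contains the zero entries outside the index range.\<close>
  define K :: "tensor set" where
    "K = {g. \<forall>i. g i \<in> {g. \<forall>j. g j \<in> {g. \<forall>k. g k \<in> {- max B 0..max B 0}}}}"
  have "compact K" unfolding K_def by (intro compact_fun_box compact_Icc)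
  then have "seq_compact K" by (rule compact_imp_seq_compact)
  moreover have "U t \<in> K" for t
  proof -
    have "\<bar>U t i j k\<bar> \<le> max B 0" for i j k
      using abs_entry_le_t_norm[of i n1 j n2 k n3 "U t"] assms(1)[of t] assms(2)[of t]
      by (cases "i < n1 \<and> j < n2 \<and> k < n3") (auto simp: tensors_def)
    then show ?thesis unfolding K_def by (simp add: abs_le_iff minus_le_iff) 
  qed
  ultimately obtain u s where "strict_mono s" "(U \<circ> s) \<longlonglongrightarrow> u"
    unfolding seq_compact_def by meson
  then show ?thesis using that by (simp add: comp_def)
qed

section \<open>Lipschitz dependence of the transformed singular values on the tensor\<close>

lemma tsv_nonneg: "i < n2 \<Longrightarrow> 0 \<le> tsv n1 n2 n3 X i k"
  by (simp add: tsv_def sing_val_nonneg)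

text \<open>Each Fourier entry is a sum of \<open>n3\<close> tensor entries with unimodular
  coefficients, which contributes the factor \<open>n3\<close>; the factors \<open>n1\<close> and
  \<open>n2\<close> come from the perturbation bound for matrices.\<close>

lemma tsv_lipschitz:
  assumes "i < n2"
  shows "\<bar>tsv n1 n2 n3 X i k - tsv n1 n2 n3 Y i k\<bar>
    \<le> real n1 * real n2 * real n3 * t_norm n1 n2 n3 (t_diff X Y)"
proof -
  have "cmod (dft3 n3 X a b k - dft3 n3 Y a b k) \<le> real n3 * t_norm n1 n2 n3 (t_diff X Y)"
    if "a < n1" "b < n2" for a b
  proof -
    have "dft3 n3 X a b k - dft3 n3 Y a b k
        = (\<Sum>q<n3. cis (- 2 * pi / real n3) ^ (k * q) * complex_of_real (t_diff X Y a b q))"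
      by (simp add: dft3_def t_diff_def right_diff_distrib flip: sum_subtractf)
    also have "cmod \<dots> \<le> (\<Sum>q<n3. t_norm n1 n2 n3 (t_diff X Y))"
      using abs_entry_le_t_norm[OF that]
      by (intro order_trans[OF norm_sum] sum_mono) (simp add: norm_mult norm_power)
    finally show ?thesis by simp
  qed
  then show ?thesis
    unfolding tsv_def using sing_val_lipschitz[OF assms, of n1 "\<lambda>a b. dft3 n3 X a b k"
        "\<lambda>a b. dft3 n3 Y a b k" "real n3 * t_norm n1 n2 n3 (t_diff X Y)"]
    by (simp add: mult.assoc)
qed

lemma tendsto_tsv:
  assumes "i < n2" "(U \<longlongrightarrow> u) F"
  shows "((\<lambda>x. tsv n1 n2 n3 (U x) i k) \<longlongrightarrow> tsv n1 n2 n3 u i k) F"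
proof -
  have "((\<lambda>x. real n1 * real n2 * real n3 * t_norm n1 n2 n3 (t_diff (U x) u)) \<longlongrightarrow> 0) F"
    using tendsto_mult_left[OF tendsto_t_norm_diff_zero[OF assms(2), of n1 n2 n3],
        of "real n1 * real n2 * real n3"] by simp
  then have "((\<lambda>x. tsv n1 n2 n3 (U x) i k - tsv n1 n2 n3 u i k) \<longlongrightarrow> 0) F"
    by (rule Lim_null_comparison[OF always_eventually, rotated])
      (simp only: real_norm_def tsv_lipschitz[OF assms(1)] simp_thms)
  then show ?thesis by (simp add: LIM_zero_iff)
qed

section \<open>Quadratic bounds for a function with Lipschitz gradient\<close>

text \<open>Subtracting or adding \<open>K / 2 * s\<^sup>2\<close> to \<open>g s - g' 0 * s\<close>
  gives a monotone function on [0, 1], so comparing its endpoint values replaces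
  integration.\<close>

lemma quadratic_bound_of_lipschitz_derivative:
  fixes g g' :: "real \<Rightarrow> real"
  assumes deriv: "\<And>s. (g has_real_derivative g' s) (at s)"
    and lip: "\<And>s. 0 \<le> s \<Longrightarrow> \<bar>g' s - g' 0\<bar> \<le> K * s"
  shows "\<bar>g 1 - g 0 - g' 0\<bar> \<le> K / 2"
proof -
  have "g 1 - g' 0 * 1 - K / 2 * 1\<^sup>2 \<le> g 0 - g' 0 * 0 - K / 2 * 0\<^sup>2"
  proof (rule DERIV_nonpos_imp_nonincreasing[where f="\<lambda>s. g s - g' 0 * s - K / 2 * s\<^sup>2"])
    fix s :: real assume s: "0 \<le> s" "s \<le> 1"
    have "((\<lambda>s. g s - g' 0 * s - K / 2 * s\<^sup>2) has_real_derivative g' s - g' 0 - K * s) (at s)"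
      by (auto intro!: derivative_eq_intros deriv)
    then show "\<exists>y. ((\<lambda>s. g s - g' 0 * s - K / 2 * s\<^sup>2) has_real_derivative y) (at s) \<and> y \<le> 0"
      using lip[OF s(1)] by (intro exI[of _ "g' s - g' 0 - K * s"]) auto
  qed simp
  moreover have "g 0 - g' 0 * 0 + K / 2 * 0\<^sup>2 \<le> g 1 - g' 0 * 1 + K / 2 * 1\<^sup>2"
  proof (rule DERIV_nonneg_imp_nondecreasing[where f="\<lambda>s. g s - g' 0 * s + K / 2 * s\<^sup>2"])
    fix s :: real assume s: "0 \<le> s" "s \<le> 1"
    have "((\<lambda>s. g s - g' 0 * s + K / 2 * s\<^sup>2) has_real_derivative g' s - g' 0 + K * s) (at s)"
      by (auto intro!: derivative_eq_intros deriv)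
    then show "\<exists>y. ((\<lambda>s. g s - g' 0 * s + K / 2 * s\<^sup>2) has_real_derivative y) (at s) \<and> 0 \<le> y"
      using lip[OF s(1)] by (intro exI[of _ "g' s - g' 0 + K * s"]) auto
  qed simp
  ultimately show ?thesis unfolding abs_le_iff by simp
qed

text \<open>Restriction to the segment \<open>\<gamma>\<close> from \<open>Z\<close> to
  \<open>W\<close>: the derivative along it deviates from its initial value by at most
  \<open>L * N\<^sup>2 * s\<close>.\<close>

lemma tensor_descent:
  assumes f_grad: "\<forall>Y\<in>tensors n1 n2 n3. \<forall>e>0. \<exists>d>0. \<forall>W\<in>tensors n1 n2 n3.
        t_norm n1 n2 n3 (t_diff W Y) < d \<longrightarrow>
        \<bar>f W - f Y - t_inner n1 n2 n3 (gf Y) (t_diff W Y)\<bar> \<le> e * t_norm n1 n2 n3 (t_diff W Y)"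
    and gf_lip: "\<forall>Y\<in>tensors n1 n2 n3. \<forall>W\<in>tensors n1 n2 n3.
        t_norm n1 n2 n3 (t_diff (gf Y) (gf W)) \<le> L * t_norm n1 n2 n3 (t_diff Y W)"
    and Z: "Z \<in> tensors n1 n2 n3" and W: "W \<in> tensors n1 n2 n3"
  shows "\<bar>f W - f Z - t_inner n1 n2 n3 (gf Z) (t_diff W Z)\<bar> \<le> L / 2 * (t_norm n1 n2 n3 (t_diff W Z))\<^sup>2"
proof -
  define D where "D = t_diff W Z"
  define N where "N = t_norm n1 n2 n3 D"
  define \<gamma> where "\<gamma> s = (\<lambda>i j k. Z i j k + s * D i j k)" for s
  define g where "g s = f (\<gamma> s)" for s
  define g' where "g' s = t_inner n1 n2 n3 (gf (\<gamma> s)) D" for s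
  have N0: "N \<ge> 0" by (simp add: N_def)
  have \<gamma>: "\<gamma> s \<in> tensors n1 n2 n3" for s
    using Z W by (auto simp: \<gamma>_def D_def tensors_def t_diff_def)
  have \<gamma>_diff: "t_diff (\<gamma> s) (\<gamma> r) = (\<lambda>i j k. (s - r) * D i j k)" for s r
    by (simp add: t_diff_def \<gamma>_def left_diff_distrib)
  have \<gamma>01: "\<gamma> 0 = Z" "\<gamma> 1 = W" by (simp_all add: \<gamma>_def D_def t_diff_def)
  have deriv: "(g has_real_derivative g' s) (at s)" for s
    unfolding has_field_derivative_def has_derivative_within_alt
  proof (intro conjI allI impI)
    fix e :: real assume "e > 0"
    \<comment> \<open>The \<open>+ 1\<close> covers the degenerate case \<open>W = Z\<close>, where
      \<open>N = 0\<close>.\<close>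
    then have "e / (N + 1) > 0" using N0 by simp
    then obtain d where d: "d > 0" "\<And>V. V \<in> tensors n1 n2 n3 \<Longrightarrow> t_norm n1 n2 n3 (t_diff V (\<gamma> s)) < d \<Longrightarrow>
        \<bar>f V - f (\<gamma> s) - t_inner n1 n2 n3 (gf (\<gamma> s)) (t_diff V (\<gamma> s))\<bar>
          \<le> e / (N + 1) * t_norm n1 n2 n3 (t_diff V (\<gamma> s))"
      using f_grad \<gamma>[of s] by blast
    show "\<exists>d>0. \<forall>r\<in>UNIV. norm (r - s) < d \<longrightarrow> norm (g r - g s - g' s * (r - s)) \<le> e * norm (r - s)"
    proof (intro exI[of _ "d / (N + 1)"] conjI ballI impI)
      show "d / (N + 1) > 0" using d(1) N0 by simp
      fix r assume "norm (r - s) < d / (N + 1)"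
      then have "\<bar>r - s\<bar> * (N + 1) < d" using N0 by (simp add: field_simps)
      then have "t_norm n1 n2 n3 (t_diff (\<gamma> r) (\<gamma> s)) < d"
        unfolding \<gamma>_diff t_norm_scale N_def[symmetric] by (simp add: algebra_simps)
      from d(2)[OF \<gamma> this] have "\<bar>g r - g s - g' s * (r - s)\<bar> \<le> e / (N + 1) * (\<bar>r - s\<bar> * N)"
        unfolding \<gamma>_diff t_norm_scale t_inner_scale_right N_def[symmetric] by (simp add: g_def g'_def mult.commute)
      also have "\<dots> = e * \<bar>r - s\<bar> * (N / (N + 1))" by simp
      also have "\<dots> \<le> e * \<bar>r - s\<bar> * 1" using N0 \<open>e > 0\<close> by (intro mult_left_mono) auto
      finally show "norm (g r - g s - g' s * (r - s)) \<le> e * norm (r - s)" by simp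
    qed
  qed (rule bounded_linear_mult_right)
  have "\<bar>g' s - g' 0\<bar> \<le> L * N\<^sup>2 * s" if "0 \<le> s" for s
  proof -
    have "\<bar>g' s - g' 0\<bar> \<le> t_norm n1 n2 n3 (t_diff (gf (\<gamma> s)) (gf (\<gamma> 0))) * N"
      unfolding g'_def N_def t_inner_diff_left[symmetric] by (rule t_inner_abs_le)
    also have "\<dots> \<le> (L * t_norm n1 n2 n3 (t_diff (\<gamma> s) (\<gamma> 0))) * N"
      using gf_lip \<gamma> N0 by (intro mult_right_mono) auto
    also have "\<dots> = L * N\<^sup>2 * s"
      unfolding \<gamma>_diff t_norm_scale N_def[symmetric] using that by (simp add: power2_eq_square)
    finally show ?thesis .
  qed
  from quadratic_bound_of_lipschitz_derivative[OF deriv this]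
  show ?thesis unfolding g_def g'_def \<gamma>01 D_def N_def by simp
qed

lemma t_norm_diff_extrap_power2:
  "(t_norm n1 n2 n3 (t_diff W (t_extrap V c U)))\<^sup>2 = (t_norm n1 n2 n3 (t_diff W V))\<^sup>2
     - 2 * c * t_inner n1 n2 n3 (t_diff W V) (t_diff V U) + c\<^sup>2 * (t_norm n1 n2 n3 (t_diff V U))\<^sup>2"
  unfolding t_norm_power2 t_inner_diff_left t_inner_diff_right t_inner_extrap_left t_inner_extrap_right
    t_inner_commute[of _ _ _ V W] t_inner_commute[of _ _ _ U W] t_inner_commute[of _ _ _ U V]
  by (simp add: algebra_simps power2_eq_square)

lemma t_norm_diff_extrap_self_power2:
  "(t_norm n1 n2 n3 (t_diff V (t_extrap V c U)))\<^sup>2 = c\<^sup>2 * (t_norm n1 n2 n3 (t_diff V U))\<^sup>2"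
proof -
  have "t_diff V (t_extrap V c U) = (\<lambda>i j k. - c * t_diff V U i j k)"
    by (simp add: t_diff_def t_extrap_def fun_eq_iff)
  then show ?thesis by (simp only: t_norm_scale power_mult_distrib power2_abs power2_minus)
qed

lemma t_diff_zero: "t_diff U t_zero = U"
  by (simp add: t_diff_def t_zero_def)

text \<open>Bounded coefficients times vanishing differences vanish. The coefficients may vary and
  be negative: \<open>- 1\<close> turns the extrapolation into the other tensor.\<close>

lemma tendsto_t_extrap:
  assumes "(U \<longlongrightarrow> u) F" "((\<lambda>x. t_diff (U x) (V x)) \<longlongrightarrow> t_zero) F" "\<And>x. \<bar>c x\<bar> \<le> 1"
  shows "((\<lambda>x. t_extrap (U x) (c x) (V x)) \<longlongrightarrow> u) F"
  unfolding tendsto_fun_iff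
proof (intro allI)
  fix i j k
  have "((\<lambda>x. U x i j k - V x i j k) \<longlongrightarrow> 0) F"
    using assms(2) by (simp add: tendsto_fun_iff t_diff_def t_zero_def)
  then have "((\<lambda>x. \<bar>U x i j k - V x i j k\<bar>) \<longlongrightarrow> 0) F" by (rule tendsto_rabs_zero)
  moreover have "norm (c x * (U x i j k - V x i j k)) \<le> \<bar>U x i j k - V x i j k\<bar>" for x
    using mult_right_mono[OF assms(3)[of x] abs_ge_zero[of "U x i j k - V x i j k"]] by (simp add: abs_mult)
  ultimately have "((\<lambda>x. c x * (U x i j k - V x i j k)) \<longlongrightarrow> 0) F"
    by (rule Lim_null_comparison[OF always_eventually[OF allI], rotated])
  moreover have "((\<lambda>x. U x i j k) \<longlongrightarrow> u i j k) F" using assms(1) by (simp add: tendsto_fun_iff)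
  ultimately have "((\<lambda>x. U x i j k + c x * (U x i j k - V x i j k)) \<longlongrightarrow> u i j k + 0) F"
    by (intro tendsto_add)
  then show "((\<lambda>x. t_extrap (U x) (c x) (V x) i j k) \<longlongrightarrow> u i j k) F"
    by (simp add: t_extrap_def)
qed

section \<open>Nested concave penalties\<close>

locale concave_penalty =
  fixes \<rho> d\<rho> :: "real \<Rightarrow> real" and Lg :: real
  assumes rho_nonneg: "t \<ge> 0 \<Longrightarrow> \<rho> t \<ge> 0"
    and rho_deriv: "t \<ge> 0 \<Longrightarrow> (\<rho> has_real_derivative d\<rho> t) (at t within {0..})"
    and rho_concave: "concave_on {0..} \<rho>"
    and drho_lip: "s \<ge> 0 \<Longrightarrow> t \<ge> 0 \<Longrightarrow> \<bar>d\<rho> s - d\<rho> t\<bar> \<le> Lg * \<bar>s - t\<bar>"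
    and drho_pos: "t \<ge> 0 \<Longrightarrow> d\<rho> t > 0"
begin

section \<open>Tangent and parabola bounds for \<open>\<rho>\<close>\<close>

text \<open>Concavity bounds the chord slope from \<open>t\<close> to \<open>s\<close> by the slope
  from \<open>t\<close> to a nearby point \<open>y\<close> between them, which is close to
  \<open>d\<rho> t\<close>. Since \<open>y\<close> stays nonnegative, the one-sided derivative at 0
  suffices.\<close>

lemma rho_below_tangent:
  assumes s: "s \<ge> 0" and t: "t \<ge> 0"
  shows "\<rho> s \<le> \<rho> t + d\<rho> t * (s - t)"
proof (rule field_le_epsilon)
  fix e :: real assume e: "e > 0"
  define e' where "e' = e / (\<bar>s - t\<bar> + 1)"
  have "e' > 0" using e by (simp add: e'_def add_nonneg_pos)
  then obtain d where d: "d > 0" "\<And>y. y \<ge> 0 \<Longrightarrow> \<bar>y - t\<bar> < d \<Longrightarrow>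
      \<bar>\<rho> y - \<rho> t - d\<rho> t * (y - t)\<bar> \<le> e' * \<bar>y - t\<bar>"
    using rho_deriv[OF t] unfolding has_field_derivative_def has_derivative_within_alt by auto
  \<comment> \<open>At most 1 for a convex combination, and small enough to bring \<open>y\<close>
    within \<open>d\<close> of \<open>t\<close>; the \<open>+ 1\<close> allows
    \<open>s = t\<close>.\<close>
  define h where "h = min 1 (d / (\<bar>s - t\<bar> + 1))"
  have h: "0 < h" "h \<le> 1" using d(1) by (auto simp: h_def add_nonneg_pos)
  define y where "y = (1 - h) * t + h * s"
  have yt: "y - t = h * (s - t)" by (simp add: y_def algebra_simps)
  have "y \<ge> 0" using s t h by (simp add: y_def)
  have "h \<le> d / (\<bar>s - t\<bar> + 1)" by (simp add: h_def)
  then have "h * (\<bar>s - t\<bar> + 1) \<le> d" by (subst (asm) pos_le_divide_eq) auto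
  moreover have "h * \<bar>s - t\<bar> < h * (\<bar>s - t\<bar> + 1)" using h by simp
  ultimately have "h * \<bar>s - t\<bar> < d" by linarith
  then have "\<bar>y - t\<bar> < d" using h by (simp add: yt abs_mult)
  from d(2)[OF \<open>y \<ge> 0\<close> this] have "\<rho> y - \<rho> t - d\<rho> t * (h * (s - t)) \<le> e' * \<bar>h * (s - t)\<bar>"
    unfolding yt by (rule abs_le_D1)
  moreover have "\<bar>h * (s - t)\<bar> = h * \<bar>s - t\<bar>" using h by (simp add: abs_mult)
  ultimately have "\<rho> y - \<rho> t \<le> h * (d\<rho> t * (s - t)) + h * (e' * \<bar>s - t\<bar>)"
    by (simp add: mult.left_commute)
  moreover have "(1 - h) * \<rho> t + h * \<rho> s \<le> \<rho> y"
    using concave_onD[OF rho_concave, of h t s] h s t by (simp add: y_def)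
  ultimately have "h * (\<rho> s - \<rho> t) \<le> h * (d\<rho> t * (s - t) + e' * \<bar>s - t\<bar>)"
    by (simp add: algebra_simps)
  then have "\<rho> s - \<rho> t \<le> d\<rho> t * (s - t) + e' * \<bar>s - t\<bar>" using h by simp
  moreover have "e' * \<bar>s - t\<bar> \<le> e' * (\<bar>s - t\<bar> + 1)" using \<open>e' > 0\<close> by simp
  moreover have "e' * (\<bar>s - t\<bar> + 1) = e" by (simp add: e'_def add_nonneg_eq_0_iff)
  ultimately show "\<rho> s \<le> \<rho> t + d\<rho> t * (s - t) + e" by linarith
qed

text \<open>Adding the tangent inequalities between 0 and \<open>t\<close> in both directions
  cancels the function values.\<close>

lemma drho_le_drho_0:
  assumes "t \<ge> 0"
  shows "d\<rho> t \<le> d\<rho> 0"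
proof (cases "t = 0")
  case False
  have "t * d\<rho> t \<le> t * d\<rho> 0"
    using rho_below_tangent[OF assms order_refl] rho_below_tangent[OF order_refl assms]
    by (simp add: mult.commute)
  with False assms show ?thesis by simp
qed simp

lemma Lg_nonneg: "Lg \<ge> 0"
  using drho_lip[of 0 1] by simp

text \<open>The tangent inequality is taken at \<open>s\<close> instead of \<open>t\<close>;
  exchanging the slope at \<open>s\<close> for that at \<open>t\<close> costs
  \<open>Lg * \<bar>s - t\<bar>\<close> per unit length.\<close>

lemma rho_above_parabola:
  assumes s: "s \<ge> 0" and t: "t \<ge> 0"
  shows "\<rho> t + d\<rho> t * (s - t) - Lg * \<bar>s - t\<bar>\<^sup>2 \<le> \<rho> s"
proof -
  have "d\<rho> t * (s - t) - d\<rho> s * (s - t) \<le> \<bar>d\<rho> t - d\<rho> s\<bar> * \<bar>s - t\<bar>"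
    by (metis abs_ge_self abs_mult left_diff_distrib)
  also have "\<dots> \<le> Lg * \<bar>t - s\<bar> * \<bar>s - t\<bar>"
    using drho_lip[OF t s] by (intro mult_right_mono) auto
  also have "\<dots> = Lg * \<bar>s - t\<bar>\<^sup>2" by (simp add: power2_eq_square abs_minus_commute)
  finally show ?thesis using rho_below_tangent[OF t s] by (simp add: algebra_simps)
qed

lemma rho_lipschitz:
  assumes s: "s \<ge> 0" and t: "t \<ge> 0"
  shows "\<bar>\<rho> s - \<rho> t\<bar> \<le> d\<rho> 0 * \<bar>s - t\<bar>"
proof -
  have *: "\<rho> a - \<rho> b \<le> d\<rho> 0 * \<bar>a - b\<bar>" if "a \<ge> 0" "b \<ge> 0" for a b
  proof -
    have "\<rho> a - \<rho> b \<le> d\<rho> b * (a - b)" using rho_below_tangent[OF that] by simp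
    also have "\<dots> \<le> d\<rho> b * \<bar>a - b\<bar>" using drho_pos[OF that(2)] by (intro mult_left_mono) auto
    also have "\<dots> \<le> d\<rho> 0 * \<bar>a - b\<bar>" using drho_le_drho_0[OF that(2)] by (intro mult_right_mono) auto
    finally show ?thesis .
  qed
  show ?thesis using *[OF s t] *[OF t s] by (simp add: abs_le_iff abs_minus_commute)
qed

lemma tendsto_rho:
  assumes "(g \<longlongrightarrow> l) F" "\<And>x. g x \<ge> 0" "l \<ge> 0"
  shows "((\<lambda>x. \<rho> (g x)) \<longlongrightarrow> \<rho> l) F"
proof -
  have "((\<lambda>x. d\<rho> 0 * \<bar>g x - l\<bar>) \<longlongrightarrow> d\<rho> 0 * \<bar>l - l\<bar>) F" by (intro tendsto_intros assms)
  then have "((\<lambda>x. d\<rho> 0 * \<bar>g x - l\<bar>) \<longlongrightarrow> 0) F" by simp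
  then have "((\<lambda>x. \<rho> (g x) - \<rho> l) \<longlongrightarrow> 0) F"
    by (rule Lim_null_comparison[OF always_eventually, rotated])
      (simp only: real_norm_def rho_lipschitz[OF assms(2,3)] simp_thms)
  then show ?thesis by (simp add: LIM_zero_iff)
qed

lemma tendsto_drho:
  assumes "(g \<longlongrightarrow> l) F" "\<And>x. g x \<ge> 0" "l \<ge> 0"
  shows "((\<lambda>x. d\<rho> (g x)) \<longlongrightarrow> d\<rho> l) F"
proof -
  have "((\<lambda>x. Lg * \<bar>g x - l\<bar>) \<longlongrightarrow> Lg * \<bar>l - l\<bar>) F" by (intro tendsto_intros assms)
  then have "((\<lambda>x. Lg * \<bar>g x - l\<bar>) \<longlongrightarrow> 0) F" by simp
  then have "((\<lambda>x. d\<rho> (g x) - d\<rho> l) \<longlongrightarrow> 0) F"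
    by (rule Lim_null_comparison[OF always_eventually, rotated])
      (simp only: real_norm_def drho_lip[OF assms(2,3)] simp_thms)
  then show ?thesis by (simp add: LIM_zero_iff)
qed

section \<open>Two-sided comparison of the triple composition with its weighted
  linearization\<close>

text \<open>The tangent inequality is applied to the outer and the middle \<open>\<rho>\<close>; the
  positive outer slope preserves the direction. The innermost \<open>\<rho>\<close> stays, as in the
  weighted function.\<close>

lemma nested_below_linearization:
  fixes \<sigma> \<tau> :: "nat \<Rightarrow> real"
  assumes "\<And>i. i < r \<Longrightarrow> \<sigma> i \<ge> 0" "\<And>i. i < r \<Longrightarrow> \<tau> i \<ge> 0"
  shows "\<rho> (\<Sum>i<r. \<rho> (\<rho> (\<tau> i))) - \<rho> (\<Sum>i<r. \<rho> (\<rho> (\<sigma> i)))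
    \<le> (\<Sum>i<r. d\<rho> (\<Sum>i<r. \<rho> (\<rho> (\<sigma> i))) * d\<rho> (\<rho> (\<sigma> i)) * (\<rho> (\<tau> i) - \<rho> (\<sigma> i)))"
proof -
  let ?u = "\<Sum>i<r. \<rho> (\<rho> (\<sigma> i))" and ?v = "\<Sum>i<r. \<rho> (\<rho> (\<tau> i))"
  have uv: "?u \<ge> 0" "?v \<ge> 0" using assms by (auto intro!: sum_nonneg rho_nonneg)
  have "\<rho> ?v - \<rho> ?u \<le> d\<rho> ?u * (?v - ?u)" using rho_below_tangent[OF uv(2,1)] by simp
  also have "\<dots> \<le> d\<rho> ?u * (\<Sum>i<r. d\<rho> (\<rho> (\<sigma> i)) * (\<rho> (\<tau> i) - \<rho> (\<sigma> i)))"
    unfolding sum_subtractf[symmetric]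
  proof (intro mult_left_mono sum_mono)
    fix i assume "i \<in> {..<r}"
    then show "\<rho> (\<rho> (\<tau> i)) - \<rho> (\<rho> (\<sigma> i)) \<le> d\<rho> (\<rho> (\<sigma> i)) * (\<rho> (\<tau> i) - \<rho> (\<sigma> i))"
      using rho_below_tangent[of "\<rho> (\<tau> i)" "\<rho> (\<sigma> i)"] assms by (simp add: rho_nonneg)
  qed (use drho_pos[OF uv(1)] in auto)
  finally show ?thesis by (simp only: sum_distrib_left mult.assoc)
qed

text \<open>Both linearized layers are replaced by their parabola bounds. With Lipschitz constant
  \<open>K = d\<rho> 0\<close>, each middle term loses \<open>Lg * (K * d)\<^sup>2\<close>, weighted
  by an outer slope of at most \<open>K\<close>, and the outer layer loses
  \<open>Lg * (r * K\<^sup>2 * d)\<^sup>2\<close>.\<close>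

lemma nested_above_linearization:
  fixes \<sigma> \<tau> :: "nat \<Rightarrow> real"
  assumes nonneg: "\<And>i. i < r \<Longrightarrow> \<sigma> i \<ge> 0" "\<And>i. i < r \<Longrightarrow> \<tau> i \<ge> 0"
    and d: "\<And>i. i < r \<Longrightarrow> \<bar>\<tau> i - \<sigma> i\<bar> \<le> d"
  shows "(\<Sum>i<r. d\<rho> (\<Sum>i<r. \<rho> (\<rho> (\<sigma> i))) * d\<rho> (\<rho> (\<sigma> i)) * (\<rho> (\<tau> i) - \<rho> (\<sigma> i)))
      - (d\<rho> 0 * (r * (Lg * (d\<rho> 0)\<^sup>2)) + Lg * (r * (d\<rho> 0)\<^sup>2)\<^sup>2) * d\<^sup>2
    \<le> \<rho> (\<Sum>i<r. \<rho> (\<rho> (\<tau> i))) - \<rho> (\<Sum>i<r. \<rho> (\<rho> (\<sigma> i)))"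
proof -
  let ?u = "\<Sum>i<r. \<rho> (\<rho> (\<sigma> i))" and ?v = "\<Sum>i<r. \<rho> (\<rho> (\<tau> i))"
  define K where "K = d\<rho> 0"
  have K: "K > 0" using drho_pos[of 0] by (simp add: K_def)
  have uv: "?u \<ge> 0" "?v \<ge> 0" using nonneg by (auto intro!: sum_nonneg rho_nonneg)
  have 1: "\<bar>\<rho> (\<tau> i) - \<rho> (\<sigma> i)\<bar> \<le> K * d" if "i < r" for i
    using rho_lipschitz[OF nonneg(2,1)[OF that]] mult_left_mono[OF d[OF that], of K] K
    unfolding K_def by linarith
  have 2: "\<bar>\<rho> (\<rho> (\<tau> i)) - \<rho> (\<rho> (\<sigma> i))\<bar> \<le> K\<^sup>2 * d" if "i < r" for i
  proof -
    have "\<bar>\<rho> (\<rho> (\<tau> i)) - \<rho> (\<rho> (\<sigma> i))\<bar> \<le> K * \<bar>\<rho> (\<tau> i) - \<rho> (\<sigma> i)\<bar>"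
      unfolding K_def using nonneg that by (intro rho_lipschitz rho_nonneg)
    also have "\<dots> \<le> K * (K * d)" using 1[OF that] K by (intro mult_left_mono) auto
    finally show ?thesis by (simp add: power2_eq_square mult.assoc)
  qed
  have 3: "\<bar>?v - ?u\<bar> \<le> r * K\<^sup>2 * d"
  proof -
    have "\<bar>?v - ?u\<bar> \<le> (\<Sum>i<r. \<bar>\<rho> (\<rho> (\<tau> i)) - \<rho> (\<rho> (\<sigma> i))\<bar>)"
      unfolding sum_subtractf[symmetric] by (rule sum_abs)
    also have "\<dots> \<le> (\<Sum>i<r. K\<^sup>2 * d)" using 2 by (intro sum_mono) auto
    finally show ?thesis by simp
  qed
  have "d\<rho> ?u * ((\<Sum>i<r. d\<rho> (\<rho> (\<sigma> i)) * (\<rho> (\<tau> i) - \<rho> (\<sigma> i))) - r * (Lg * (K * d)\<^sup>2)) \<le> d\<rho> ?u * (?v - ?u)"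
  proof (rule mult_left_mono)
    have "(\<Sum>i<r. d\<rho> (\<rho> (\<sigma> i)) * (\<rho> (\<tau> i) - \<rho> (\<sigma> i)) - Lg * (K * d)\<^sup>2) \<le> ?v - ?u"
      unfolding sum_subtractf[symmetric, of "\<lambda>i. \<rho> (\<rho> (\<tau> i))"]
    proof (rule sum_mono)
      fix i assume "i \<in> {..<r}"
      then have i: "i < r" by simp
      have "Lg * \<bar>\<rho> (\<tau> i) - \<rho> (\<sigma> i)\<bar>\<^sup>2 \<le> Lg * (K * d)\<^sup>2"
        using 1[OF i] Lg_nonneg by (intro mult_left_mono power_mono) auto
      then show "d\<rho> (\<rho> (\<sigma> i)) * (\<rho> (\<tau> i) - \<rho> (\<sigma> i)) - Lg * (K * d)\<^sup>2 \<le> \<rho> (\<rho> (\<tau> i)) - \<rho> (\<rho> (\<sigma> i))"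
        using rho_above_parabola[of "\<rho> (\<tau> i)" "\<rho> (\<sigma> i)"] nonneg i by (simp add: rho_nonneg)
    qed
    then show "(\<Sum>i<r. d\<rho> (\<rho> (\<sigma> i)) * (\<rho> (\<tau> i) - \<rho> (\<sigma> i))) - r * (Lg * (K * d)\<^sup>2) \<le> ?v - ?u"
      by (simp add: sum_subtractf)
  qed (use drho_pos[OF uv(1)] in simp)
  moreover have "d\<rho> ?u * (r * (Lg * (K * d)\<^sup>2)) \<le> K * (r * (Lg * (K * d)\<^sup>2))"
    using drho_le_drho_0[OF uv(1)] Lg_nonneg unfolding K_def by (intro mult_right_mono) auto
  moreover have "Lg * \<bar>?v - ?u\<bar>\<^sup>2 \<le> Lg * (r * K\<^sup>2 * d)\<^sup>2"
    using 3 Lg_nonneg by (intro mult_left_mono power_mono) auto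
  moreover have "\<rho> ?u + d\<rho> ?u * (?v - ?u) - Lg * \<bar>?v - ?u\<bar>\<^sup>2 \<le> \<rho> ?v"
    by (rule rho_above_parabola[OF uv(2,1)])
  ultimately have "d\<rho> ?u * (\<Sum>i<r. d\<rho> (\<rho> (\<sigma> i)) * (\<rho> (\<tau> i) - \<rho> (\<sigma> i)))
      - (K * (r * (Lg * (K * d)\<^sup>2)) + Lg * (r * K\<^sup>2 * d)\<^sup>2) \<le> \<rho> ?v - \<rho> ?u"
    unfolding right_diff_distrib by linarith
  moreover have "K * (r * (Lg * (K * d)\<^sup>2)) + Lg * (r * K\<^sup>2 * d)\<^sup>2
      = (K * (r * (Lg * K\<^sup>2)) + Lg * (r * K\<^sup>2)\<^sup>2) * d\<^sup>2"
    by (simp add: power_mult_distrib algebra_simps)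
  ultimately show ?thesis unfolding K_def by (simp only: sum_distrib_left mult.assoc)
qed

end

section \<open>The TNNR iteration\<close>

text \<open>\<open>A\<close> and \<open>B\<close> stand for the squared lengths of the new and the
  previous step, \<open>P\<close> for their inner product. Right side minus left side is the first
  nonnegative product below plus half of each of the other two.\<close>

lemma inertial_descent_arith:
  fixes A B P :: real
  assumes "\<theta>2 * L \<le> \<mu> * \<theta>1" "P \<le> (A + B) / 2" "0 \<le> A" "0 \<le> B" "0 \<le> \<theta>2" "\<theta>2 \<le> 1 / 2" "0 \<le> L"
    and "(1 - \<theta>2) * L \<le> \<mu> * (1 - \<theta>1 - \<theta>1' - \<epsilon>)"
  shows "\<mu> / 2 * (\<theta>1\<^sup>2 * B - (A - 2 * \<theta>1 * P + \<theta>1\<^sup>2 * B)) + L / 2 * ((A - 2 * \<theta>2 * P + \<theta>2\<^sup>2 * B) + \<theta>2\<^sup>2 * B)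
    \<le> \<mu> / 2 * \<theta>1 * B - \<mu> / 2 * (\<theta>1' + \<epsilon>) * A"
proof -
  have "0 \<le> (\<mu> * \<theta>1 - \<theta>2 * L) * ((A + B) / 2 - P)" using assms by (intro mult_nonneg_nonneg) auto
  moreover have "0 \<le> (\<mu> * (1 - \<theta>1 - \<theta>1' - \<epsilon>) - (1 - \<theta>2) * L) * A"
    using assms by (intro mult_nonneg_nonneg) auto
  moreover have "0 \<le> L * \<theta>2 * (1 - 2 * \<theta>2) * B" using assms by (intro mult_nonneg_nonneg) auto
  ultimately show ?thesis by (simp add: field_simps power2_eq_square)
qed

text \<open>The lower bound \<open>\<theta>2 t * Lf / \<theta>1 t\<close> on \<open>\<mu> t\<close>
  is multiplied out, so that \<open>\<theta>1 t = 0\<close> is meaningful and forces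
  \<open>\<theta>2 t = 0\<close>.\<close>

locale tnnr = concave_penalty \<rho> d\<rho> Lg
  for \<rho> d\<rho> :: "real \<Rightarrow> real" and Lg :: real +
  fixes n1 n2 n3 :: nat
    and f :: "tensor \<Rightarrow> real" and gf :: "tensor \<Rightarrow> tensor" and Lf :: real
    and lam \<epsilon> :: real
    and \<theta>1 \<theta>2 \<mu> :: "nat \<Rightarrow> real"
    and X :: "nat \<Rightarrow> tensor"
  assumes gf_tensor: "\<forall>Y\<in>tensors n1 n2 n3. gf Y \<in> tensors n1 n2 n3"
    and f_grad: "\<forall>Y\<in>tensors n1 n2 n3. \<forall>e>0. \<exists>d>0. \<forall>W\<in>tensors n1 n2 n3.
        t_norm n1 n2 n3 (t_diff W Y) < d \<longrightarrow>
        \<bar>f W - f Y - t_inner n1 n2 n3 (gf Y) (t_diff W Y)\<bar> \<le> e * t_norm n1 n2 n3 (t_diff W Y)"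
    and Lf_pos: "Lf > 0"
    and gf_lip: "\<forall>Y\<in>tensors n1 n2 n3. \<forall>W\<in>tensors n1 n2 n3.
        t_norm n1 n2 n3 (t_diff (gf Y) (gf W)) \<le> Lf * t_norm n1 n2 n3 (t_diff Y W)"
    and lam_pos: "lam > 0"
    and F_coercive: "\<forall>M. \<exists>R. \<forall>Y\<in>tensors n1 n2 n3.
        t_norm n1 n2 n3 Y \<ge> R \<longrightarrow> objF n1 n2 n3 \<rho> lam f Y \<ge> M"
    and F_bdd_below: "\<exists>c. \<forall>Y\<in>tensors n1 n2 n3. objF n1 n2 n3 \<rho> lam f Y \<ge> c"
    and eps: "0 < \<epsilon>" "\<epsilon> < 1"
    and theta1: "\<forall>t. 0 \<le> \<theta>1 t \<and> \<theta>1 t < (1 - \<epsilon>) / 2"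
    and theta2: "\<forall>t. 0 \<le> \<theta>2 t \<and> \<theta>2 t \<le> 1 / 2"
    and mu_mono: "\<forall>t. \<mu> (Suc t) \<le> \<mu> t"
    and mu_le: "\<forall>t. \<mu> t \<le> \<mu> 0"
    and mu_ge1: "\<forall>t. \<theta>2 t * Lf \<le> \<mu> t * \<theta>1 t"
    and mu_ge2: "\<forall>t. (1 - \<theta>2 t) * Lf / (1 - \<theta>1 t - \<theta>1 (Suc t) - \<epsilon>) \<le> \<mu> t"
    and X_tensor: "\<forall>t. X t \<in> tensors n1 n2 n3"
    and X_step: "\<forall>t. \<forall>W\<in>tensors n1 n2 n3.
        (let Xp = (if t = 0 then X 0 else X (t - 1));
             Y = t_extrap (X t) (\<theta>1 t) Xp;
             Z = t_extrap (X t) (\<theta>2 t) Xp;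
             \<alpha> = (\<lambda>k. d\<rho> (\<Sum>i<min n1 n2. \<rho> (\<rho> (tsv n1 n2 n3 (X t) i k))));
             \<beta> = (\<lambda>i k. d\<rho> (\<rho> (tsv n1 n2 n3 (X t) i k)));
             obj = (\<lambda>V. lam * wnorm n1 n2 n3 \<rho> \<alpha> \<beta> V + t_inner n1 n2 n3 (t_diff V Y) (gf Z)
                        + \<mu> t / 2 * (t_norm n1 n2 n3 (t_diff V Y))\<^sup>2)
         in obj (X (Suc t)) \<le> obj W)"
begin

section \<open>The regularizer, its linearization and the subproblems\<close>

abbreviation "T \<equiv> tensors n1 n2 n3"
abbreviation "ip \<equiv> t_inner n1 n2 n3"
abbreviation "nrm \<equiv> t_norm n1 n2 n3"
abbreviation "sv \<equiv> tsv n1 n2 n3"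
abbreviation "r \<equiv> min n1 n2"
abbreviation "F \<equiv> objF n1 n2 n3 \<rho> lam f"

definition reg :: "tensor \<Rightarrow> real" where
  "reg W = (\<Sum>k<n3. \<rho> (\<Sum>i<r. \<rho> (\<rho> (sv W i k))))"

definition lin :: "tensor \<Rightarrow> tensor \<Rightarrow> real" where
  "lin V W = wnorm n1 n2 n3 \<rho> (\<lambda>k. d\<rho> (\<Sum>i<r. \<rho> (\<rho> (sv V i k)))) (\<lambda>i k. d\<rho> (\<rho> (sv V i k))) W"

text \<open>The convention that the iterate before \<open>X 0\<close> is \<open>X 0\<close> itself;
  the first step is thus not extrapolated.\<close>

definition prev :: "nat \<Rightarrow> tensor" where "prev t = (if t = 0 then X 0 else X (t - 1))"
definition Yt :: "nat \<Rightarrow> tensor" where "Yt t = t_extrap (X t) (\<theta>1 t) (prev t)"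
definition Zt :: "nat \<Rightarrow> tensor" where "Zt t = t_extrap (X t) (\<theta>2 t) (prev t)"

lemma F_eq: "F W = lam * reg W + f W"
  by (simp add: objF_def reg_def)

lemma prev_Suc [simp]: "prev (Suc t) = X t"
  by (simp add: prev_def)

lemma tensor_mem [simp]: "X t \<in> T" "prev t \<in> T" "Yt t \<in> T" "Zt t \<in> T"
  using X_tensor by (simp_all add: prev_def Yt_def Zt_def tensor_operations_closed)

lemma sv_nonneg: "i < r \<Longrightarrow> sv W i k \<ge> 0"
  by (simp add: tsv_nonneg)

lemma step:
  assumes "W \<in> T"
  shows "lam * lin (X t) (X (Suc t)) + ip (t_diff (X (Suc t)) (Yt t)) (gf (Zt t))
       + \<mu> t / 2 * (nrm (t_diff (X (Suc t)) (Yt t)))\<^sup>2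
     \<le> lam * lin (X t) W + ip (t_diff W (Yt t)) (gf (Zt t)) + \<mu> t / 2 * (nrm (t_diff W (Yt t)))\<^sup>2"
  using X_step[rule_format, OF assms, of t] unfolding Let_def lin_def Yt_def Zt_def prev_def .

lemma lin_diff:
  "lin V W - lin V V = (\<Sum>k<n3. \<Sum>i<r. d\<rho> (\<Sum>i<r. \<rho> (\<rho> (sv V i k))) * d\<rho> (\<rho> (sv V i k)) * (\<rho> (sv W i k) - \<rho> (sv V i k)))"
  by (simp add: lin_def wnorm_def right_diff_distrib sum_subtractf)

lemma reg_below_linearization: "reg W - reg V \<le> lin V W - lin V V"
  unfolding lin_diff reg_def sum_subtractf[symmetric]
  by (intro sum_mono nested_below_linearization sv_nonneg)

text \<open>The error constant of \<open>nested_above_linearization\<close> with the Lipschitz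
  constant of the singular values inserted for \<open>d\<close>, summed over the \<open>n3\<close>
  slices.\<close>

definition "reg_const =
  n3 * ((d\<rho> 0 * (r * (Lg * (d\<rho> 0)\<^sup>2)) + Lg * (r * (d\<rho> 0)\<^sup>2)\<^sup>2) * (real n1 * real n2 * real n3)\<^sup>2)"

lemma reg_above_linearization:
  "lin V W - lin V V - reg_const * (nrm (t_diff W V))\<^sup>2 \<le> reg W - reg V"
proof -
  let ?D = "real n1 * real n2 * real n3 * nrm (t_diff W V)"
  let ?C = "d\<rho> 0 * (r * (Lg * (d\<rho> 0)\<^sup>2)) + Lg * (r * (d\<rho> 0)\<^sup>2)\<^sup>2"
  have "(\<Sum>k<n3. (\<Sum>i<r. d\<rho> (\<Sum>i<r. \<rho> (\<rho> (sv V i k))) * d\<rho> (\<rho> (sv V i k)) * (\<rho> (sv W i k) - \<rho> (sv V i k)))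
      - ?C * ?D\<^sup>2) \<le> reg W - reg V"
    unfolding reg_def sum_subtractf[symmetric, of "\<lambda>k. \<rho> (\<Sum>i<r. \<rho> (\<rho> (sv W i k)))"]
    by (intro sum_mono nested_above_linearization sv_nonneg tsv_lipschitz) auto
  then have "lin V W - lin V V - n3 * (?C * ?D\<^sup>2) \<le> reg W - reg V"
    unfolding sum_subtractf[of _ "\<lambda>k. ?C * ?D\<^sup>2"] lin_diff by simp
  then show ?thesis unfolding reg_const_def power_mult_distrib by (simp only: mult.assoc)
qed

lemma f_quadratic:
  assumes "Z \<in> T" "W \<in> T"
  shows "\<bar>f W - f Z - ip (gf Z) (t_diff W Z)\<bar> \<le> Lf / 2 * (nrm (t_diff W Z))\<^sup>2"
  by (rule tensor_descent[OF f_grad gf_lip assms])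

section \<open>Decrease of the energy and its consequences\<close>

text \<open>Two values of \<open>\<theta>1\<close> sum to less than \<open>1 - \<epsilon>\<close>,
  so the denominator lies in (0, 1] and can be cleared; \<open>\<theta>2 t \<le> 1 / 2\<close> then
  gives the uniform lower bound on \<open>\<mu>\<close>.\<close>

lemma mu_facts:
  shows "(1 - \<theta>2 t) * Lf \<le> \<mu> t * (1 - \<theta>1 t - \<theta>1 (Suc t) - \<epsilon>)" "Lf / 2 \<le> \<mu> t"
proof -
  let ?d = "1 - \<theta>1 t - \<theta>1 (Suc t) - \<epsilon>"
  have d: "0 < ?d" "?d \<le> 1"
    using theta1[rule_format, of t] theta1[rule_format, of "Suc t"] eps by (auto simp: field_simps)
  show 1: "(1 - \<theta>2 t) * Lf \<le> \<mu> t * ?d"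
    using mu_ge2[rule_format, of t] d by (simp add: pos_divide_le_eq)
  have 2: "1 / 2 * Lf \<le> (1 - \<theta>2 t) * Lf"
    using theta2[rule_format, of t] Lf_pos by (intro mult_right_mono) auto
  with 1 Lf_pos have "0 < \<mu> t * ?d" by linarith
  then have "\<mu> t > 0" using d by (simp add: zero_less_mult_iff)
  then have "\<mu> t * ?d \<le> \<mu> t * 1" using d by (intro mult_left_mono) auto
  with 1 2 show "Lf / 2 \<le> \<mu> t" by simp
qed

lemma mu_pos: "\<mu> t > 0"
  using mu_facts(2)[of t] Lf_pos by linarith

definition gap :: "nat \<Rightarrow> real" where "gap t = nrm (t_diff (X t) (prev t))"

definition energy :: "nat \<Rightarrow> real" where
  "energy t = F (X t) + \<mu> t / 2 * \<theta>1 t * (gap t)\<^sup>2"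

text \<open>Minimality is tested with the current iterate \<open>X t\<close>, and \<open>f\<close>
  is bounded above at the new and below at the current iterate. All gradients are taken at
  \<open>Zt t\<close>, so the linear terms cancel and only \<open>inertial_descent_arith\<close>
  remains.\<close>

lemma F_descent:
  "F (X (Suc t)) \<le> F (X t) + \<mu> t / 2 * \<theta>1 t * (gap t)\<^sup>2 - \<mu> t / 2 * (\<theta>1 (Suc t) + \<epsilon>) * (gap (Suc t))\<^sup>2"
proof -
  let ?X = "X (Suc t)" and ?g = "gf (Zt t)"
  define P where "P = ip (t_diff ?X (X t)) (t_diff (X t) (prev t))"
  define A where "A = (gap (Suc t))\<^sup>2"
  define B where "B = (gap t)\<^sup>2"
  have AB: "0 \<le> A" "0 \<le> B" by (auto simp: A_def B_def)
  \<comment> \<open>Cauchy-Schwarz followed by the inequality of arithmetic and geometric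
    means.\<close>
  have P: "P \<le> (A + B) / 2"
  proof -
    have "P \<le> gap (Suc t) * gap t"
      unfolding P_def gap_def prev_Suc using t_inner_abs_le abs_le_D1 by blast
    moreover have "0 \<le> (gap (Suc t) - gap t)\<^sup>2" by simp
    ultimately show ?thesis unfolding A_def B_def by (simp add: power2_diff)
  qed
  have XY: "(nrm (t_diff ?X (Yt t)))\<^sup>2 = A - 2 * \<theta>1 t * P + (\<theta>1 t)\<^sup>2 * B"
    "(nrm (t_diff (X t) (Yt t)))\<^sup>2 = (\<theta>1 t)\<^sup>2 * B"
    "(nrm (t_diff ?X (Zt t)))\<^sup>2 = A - 2 * \<theta>2 t * P + (\<theta>2 t)\<^sup>2 * B"
    "(nrm (t_diff (X t) (Zt t)))\<^sup>2 = (\<theta>2 t)\<^sup>2 * B"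
    unfolding Yt_def Zt_def t_norm_diff_extrap_self_power2
    by (simp_all add: t_norm_diff_extrap_power2 A_def B_def P_def gap_def)
  have "lam * (reg ?X - reg (X t)) \<le> lam * (lin (X t) ?X - lin (X t) (X t))"
    using reg_below_linearization lam_pos by (intro mult_left_mono) auto
  moreover have "lam * lin (X t) ?X + ip ?X ?g + \<mu> t / 2 * (A - 2 * \<theta>1 t * P + (\<theta>1 t)\<^sup>2 * B)
      \<le> lam * lin (X t) (X t) + ip (X t) ?g + \<mu> t / 2 * ((\<theta>1 t)\<^sup>2 * B)"
    using step[of "X t" t] unfolding XY t_inner_diff_left by simp
  moreover have "f ?X \<le> f (Zt t) + (ip ?X ?g - ip (Zt t) ?g) + Lf / 2 * (A - 2 * \<theta>2 t * P + (\<theta>2 t)\<^sup>2 * B)"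
    using f_quadratic[of "Zt t" ?X] unfolding XY t_inner_commute[of _ _ _ ?g] t_inner_diff_left abs_le_iff by simp
  moreover have "f (X t) \<ge> f (Zt t) + (ip (X t) ?g - ip (Zt t) ?g) - Lf / 2 * ((\<theta>2 t)\<^sup>2 * B)"
    using f_quadratic[of "Zt t" "X t"] unfolding XY t_inner_commute[of _ _ _ ?g] t_inner_diff_left abs_le_iff by simp
  moreover have "\<mu> t / 2 * ((\<theta>1 t)\<^sup>2 * B - (A - 2 * \<theta>1 t * P + (\<theta>1 t)\<^sup>2 * B))
      + Lf / 2 * ((A - 2 * \<theta>2 t * P + (\<theta>2 t)\<^sup>2 * B) + (\<theta>2 t)\<^sup>2 * B)
    \<le> \<mu> t / 2 * \<theta>1 t * B - \<mu> t / 2 * (\<theta>1 (Suc t) + \<epsilon>) * A"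
    using mu_ge1 P AB theta2 Lf_pos mu_facts(1) by (intro inertial_descent_arith) auto
  ultimately show ?thesis unfolding F_eq A_def[symmetric] B_def[symmetric] right_diff_distrib distrib_left
    by linarith
qed

text \<open>Monotonicity of \<open>\<mu>\<close> lets the \<open>\<theta>1 (Suc t)\<close> share of
  the decrease pay for the inertial term of the next energy; the \<open>\<epsilon>\<close> share
  survives, with \<open>\<mu> t \<ge> Lf / 2\<close>.\<close>

lemma energy_descent: "energy (Suc t) \<le> energy t - Lf * \<epsilon> / 4 * (gap (Suc t))\<^sup>2"
proof -
  have "\<mu> (Suc t) / 2 * \<theta>1 (Suc t) * (gap (Suc t))\<^sup>2 \<le> \<mu> t / 2 * \<theta>1 (Suc t) * (gap (Suc t))\<^sup>2"
    using mu_mono theta1 by (intro mult_right_mono) auto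
  moreover have "Lf * \<epsilon> / 4 * (gap (Suc t))\<^sup>2 \<le> \<mu> t / 2 * \<epsilon> * (gap (Suc t))\<^sup>2"
    using mult_right_mono[OF mu_facts(2)[of t], of \<epsilon>] eps by (intro mult_right_mono) auto
  moreover have "\<mu> t / 2 * (\<theta>1 (Suc t) + \<epsilon>) * (gap (Suc t))\<^sup>2
      = \<mu> t / 2 * \<theta>1 (Suc t) * (gap (Suc t))\<^sup>2 + \<mu> t / 2 * \<epsilon> * (gap (Suc t))\<^sup>2"
    by (simp add: algebra_simps)
  ultimately show ?thesis using F_descent[of t] unfolding energy_def by linarith
qed

lemma energy_ge_F: "F (X t) \<le> energy t"
  using mu_pos[of t] theta1 unfolding energy_def by simp

lemma energy_decseq: "decseq energy"
proof (rule decseq_SucI)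
  fix t
  have "0 \<le> Lf * \<epsilon> / 4 * (gap (Suc t))\<^sup>2" using Lf_pos eps by simp
  then show "energy (Suc t) \<le> energy t" using energy_descent[of t] by linarith
qed

lemma energy_convergent: "convergent energy"
proof -
  obtain c where c: "\<forall>Y\<in>T. F Y \<ge> c" using F_bdd_below by blast
  then have "c \<le> energy t" for t using energy_ge_F[of t] tensor_mem(1)[of t] by (meson order_trans)
  then show ?thesis using decseq_convergent[OF energy_decseq, of c] by (metis convergentI)
qed

lemma gap_tendsto_0: "gap \<longlonglongrightarrow> 0"
proof -
  obtain l where l: "energy \<longlonglongrightarrow> l" using energy_convergent by (auto simp: convergent_def)
  have "(\<lambda>t. 4 / (Lf * \<epsilon>) * (energy t - energy (Suc t))) \<longlonglongrightarrow> 4 / (Lf * \<epsilon>) * (l - l)"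
    by (intro tendsto_intros l LIMSEQ_Suc)
  then have lim: "(\<lambda>t. 4 / (Lf * \<epsilon>) * (energy t - energy (Suc t))) \<longlonglongrightarrow> 0" by simp
  have "norm ((gap (Suc t))\<^sup>2) \<le> 4 / (Lf * \<epsilon>) * (energy t - energy (Suc t))" for t
    using energy_descent[of t] Lf_pos eps by (simp add: field_simps)
  then have "(\<lambda>t. (gap (Suc t))\<^sup>2) \<longlonglongrightarrow> 0"
    by (intro Lim_null_comparison[OF always_eventually lim]) simp
  then have "(\<lambda>t. sqrt ((gap (Suc t))\<^sup>2)) \<longlonglongrightarrow> sqrt 0" by (rule tendsto_real_sqrt)
  then have "(\<lambda>t. gap (Suc t)) \<longlonglongrightarrow> 0" by (simp add: gap_def)
  then show ?thesis by (rule LIMSEQ_imp_Suc)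
qed

text \<open>All values \<open>F (X t)\<close> stay below \<open>energy 0\<close>, whereas coercivity
  pushes \<open>F\<close> above \<open>energy 0 + 1\<close> far out.\<close>

lemma iterates_bounded: "\<exists>B. \<forall>t. nrm (X t) \<le> B"
proof -
  obtain R where R: "\<forall>Y\<in>T. nrm Y \<ge> R \<longrightarrow> F Y \<ge> energy 0 + 1" using F_coercive by blast
  have "nrm (X t) \<le> R" for t
  proof (rule ccontr)
    assume "\<not> nrm (X t) \<le> R"
    then have "F (X t) \<ge> energy 0 + 1" using R by simp
    moreover have "energy t \<le> energy 0" using energy_decseq by (simp add: decseqD)
    ultimately show False using energy_ge_F[of t] by linarith
  qed
  then show ?thesis by blast
qed

lemma F_convergent: "convergent (\<lambda>t. F (X t))"
proof -
  obtain l where l: "energy \<longlonglongrightarrow> l" using energy_convergent by (auto simp: convergent_def)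
  have "(\<lambda>t. \<mu> 0 * (gap t)\<^sup>2) \<longlonglongrightarrow> \<mu> 0 * 0\<^sup>2" by (intro tendsto_intros gap_tendsto_0)
  then have lim: "(\<lambda>t. \<mu> 0 * (gap t)\<^sup>2) \<longlonglongrightarrow> 0" by simp
  have "norm (\<mu> t / 2 * \<theta>1 t * (gap t)\<^sup>2) \<le> \<mu> 0 * (gap t)\<^sup>2" for t
  proof -
    have "\<theta>1 t \<le> 2" using theta1[rule_format, of t] eps by simp
    then have "\<mu> t / 2 * \<theta>1 t \<le> \<mu> t / 2 * 2" using mu_pos[of t] by (intro mult_left_mono) auto
    then have "\<mu> t / 2 * \<theta>1 t \<le> \<mu> 0" using mu_le[rule_format, of t] by simp
    then have "\<mu> t / 2 * \<theta>1 t * (gap t)\<^sup>2 \<le> \<mu> 0 * (gap t)\<^sup>2" by (rule mult_right_mono) simp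
    then show ?thesis using mu_pos[of t] theta1 by (simp add: abs_mult)
  qed
  then have "(\<lambda>t. \<mu> t / 2 * \<theta>1 t * (gap t)\<^sup>2) \<longlonglongrightarrow> 0"
    by (intro Lim_null_comparison[OF always_eventually lim]) simp
  from tendsto_diff[OF l this] show ?thesis unfolding convergent_def energy_def by auto
qed

section \<open>Continuity of the functions involved\<close>

text \<open>Joint continuity, weights included: it is what lets minimality pass to the limit while
  every subproblem carries its own weights.\<close>

lemma tendsto_lin:
  assumes "(U \<longlongrightarrow> u) G" "(V \<longlongrightarrow> v) G"
  shows "((\<lambda>x. lin (U x) (V x)) \<longlongrightarrow> lin u v) G"
  unfolding lin_def wnorm_def
  by (intro tendsto_sum tendsto_mult tendsto_drho tendsto_rho tendsto_tsv assms sum_nonneg rho_nonneg sv_nonneg) auto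

lemma tendsto_reg:
  assumes "(U \<longlongrightarrow> u) G"
  shows "((\<lambda>x. reg (U x)) \<longlongrightarrow> reg u) G"
  unfolding reg_def
  by (intro tendsto_sum tendsto_rho tendsto_tsv assms sum_nonneg rho_nonneg sv_nonneg) auto

lemma tendsto_F:
  assumes U: "(U \<longlongrightarrow> u) G" and UT: "\<And>x. U x \<in> T" and uT: "u \<in> T"
  shows "((\<lambda>x. F (U x)) \<longlongrightarrow> F u) G"
proof -
  have "((\<lambda>x. Lf / 2 * (nrm (t_diff (U x) u))\<^sup>2) \<longlongrightarrow> Lf / 2 * 0\<^sup>2) G"
    by (intro tendsto_mult tendsto_power tendsto_const tendsto_t_norm_diff_zero U)
  then have lim: "((\<lambda>x. Lf / 2 * (nrm (t_diff (U x) u))\<^sup>2) \<longlongrightarrow> 0) G" by simp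
  have "((\<lambda>x. f (U x) - f u - ip (gf u) (t_diff (U x) u)) \<longlongrightarrow> 0) G"
    by (rule Lim_null_comparison[OF always_eventually lim])
      (simp only: real_norm_def f_quadratic[OF uT UT] simp_thms)
  moreover have "((\<lambda>x. f u + ip (gf u) (t_diff (U x) u)) \<longlongrightarrow> f u + ip (gf u) (t_diff u u)) G"
    by (intro tendsto_add tendsto_const tendsto_t_inner tendsto_t_diff U)
  ultimately have "((\<lambda>x. f (U x) - f u - ip (gf u) (t_diff (U x) u) + (f u + ip (gf u) (t_diff (U x) u)))
      \<longlongrightarrow> 0 + (f u + ip (gf u) (t_diff u u))) G" by (rule tendsto_add)
  then have "((\<lambda>x. f (U x)) \<longlongrightarrow> f u) G" by (simp add: t_inner_diff_right)
  then show ?thesis unfolding F_eq by (intro tendsto_add tendsto_mult tendsto_const tendsto_reg U)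
qed

lemma diff_prev_tendsto: "(\<lambda>t. t_diff (X t) (prev t)) \<longlonglongrightarrow> t_zero"
proof (rule tendsto_tensorI)
  show "t_diff (X t) (prev t) \<in> T" for t by (simp add: tensor_operations_closed)
  show "t_zero \<in> T" by (simp add: t_zero_def tensors_def)
  show "(\<lambda>t. nrm (t_diff (t_diff (X t) (prev t)) t_zero)) \<longlonglongrightarrow> 0"
    using gap_tendsto_0 unfolding gap_def[abs_def] by (simp add: t_diff_zero)
qed

lemma diff_next_tendsto: "(\<lambda>t. t_diff (X t) (X (Suc t))) \<longlonglongrightarrow> t_zero"
proof -
  have "(\<lambda>t. t_diff (X (Suc t)) (prev (Suc t))) \<longlonglongrightarrow> t_zero"
    by (rule LIMSEQ_Suc[OF diff_prev_tendsto])
  then have "(\<lambda>t. - (X (Suc t) i j k - X t i j k)) \<longlonglongrightarrow> - 0" for i j k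
    unfolding prev_Suc tendsto_fun_iff t_diff_def t_zero_def by (intro tendsto_minus) auto
  then show ?thesis unfolding tendsto_fun_iff t_diff_def t_zero_def by simp
qed

section \<open>Stationarity of an accumulation point\<close>

context
  fixes Xs :: tensor and s :: "nat \<Rightarrow> nat"
  assumes s: "strict_mono s" and lim: "(\<lambda>l. X (s l)) \<longlonglongrightarrow> Xs"
begin

lemma limit_tensor: "Xs \<in> T"
  using tensors_limit[OF _ lim] by simp

lemma next_tendsto: "(\<lambda>l. X (Suc (s l))) \<longlonglongrightarrow> Xs"
proof -
  \<comment> \<open>Extrapolating with coefficient \<open>- 1\<close> gives exactly
    \<open>X (Suc (s l))\<close>.\<close>
  have "(\<lambda>l. t_extrap (X (s l)) (- 1) (X (Suc (s l)))) \<longlonglongrightarrow> Xs"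
    using LIMSEQ_subseq_LIMSEQ[OF diff_next_tendsto s]
    by (intro tendsto_t_extrap lim) (simp_all add: comp_def)
  then show ?thesis by (simp add: t_extrap_def)
qed

lemma extrapolations_tendsto: "(\<lambda>l. Yt (s l)) \<longlonglongrightarrow> Xs" "(\<lambda>l. Zt (s l)) \<longlonglongrightarrow> Xs"
proof -
  have d: "(\<lambda>l. t_diff (X (s l)) (prev (s l))) \<longlonglongrightarrow> t_zero"
    using LIMSEQ_subseq_LIMSEQ[OF diff_prev_tendsto s] by (simp add: comp_def)
  have "\<bar>\<theta>1 t\<bar> \<le> 1" "\<bar>\<theta>2 t\<bar> \<le> 1" for t
    using theta1[rule_format, of t] theta2[rule_format, of t] eps by auto
  then show "(\<lambda>l. Yt (s l)) \<longlonglongrightarrow> Xs" "(\<lambda>l. Zt (s l)) \<longlonglongrightarrow> Xs"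
    unfolding Yt_def Zt_def by (auto intro!: tendsto_t_extrap lim d)
qed

lemma gradient_tendsto: "(\<lambda>l. gf (Zt (s l))) \<longlonglongrightarrow> gf Xs"
proof (rule tendsto_tensorI)
  show "gf (Zt (s l)) \<in> T" for l using gf_tensor by simp
  show "gf Xs \<in> T" using gf_tensor limit_tensor by simp
  have "(\<lambda>l. Lf * nrm (t_diff (Zt (s l)) Xs)) \<longlonglongrightarrow> Lf * 0"
    by (intro tendsto_mult tendsto_const tendsto_t_norm_diff_zero extrapolations_tendsto)
  then have l: "(\<lambda>l. Lf * nrm (t_diff (Zt (s l)) Xs)) \<longlonglongrightarrow> 0" by simp
  show "(\<lambda>l. nrm (t_diff (gf (Zt (s l))) (gf Xs))) \<longlonglongrightarrow> 0"
    using gf_lip limit_tensor by (intro Lim_null_comparison[OF always_eventually l]) simp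
qed

lemma limit_minimizes:
  assumes "W \<in> T"
  shows "0 \<le> lam * (lin Xs W - lin Xs Xs) + ip (t_diff W Xs) (gf Xs) + \<mu> 0 / 2 * (nrm (t_diff W Xs))\<^sup>2"
proof -
  have "0 \<le> lam * (lin (X (s l)) W - lin (X (s l)) (X (Suc (s l))))
      + (ip (t_diff W (Yt (s l))) (gf (Zt (s l))) - ip (t_diff (X (Suc (s l))) (Yt (s l))) (gf (Zt (s l))))
      + \<mu> 0 / 2 * (nrm (t_diff W (Yt (s l))))\<^sup>2" for l
  proof -
    \<comment> \<open>The quadratic term of \<open>W\<close> is enlarged to the constant coefficient
      \<open>\<mu> 0\<close> and that of the minimizer is dropped, so no varying
      \<open>\<mu>\<close> remains when \<open>l\<close> tends to infinity.\<close>
    have "\<mu> (s l) / 2 * (nrm (t_diff W (Yt (s l))))\<^sup>2 \<le> \<mu> 0 / 2 * (nrm (t_diff W (Yt (s l))))\<^sup>2"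
      using mu_le by (intro mult_right_mono) auto
    moreover have "0 \<le> \<mu> (s l) / 2 * (nrm (t_diff (X (Suc (s l))) (Yt (s l))))\<^sup>2"
      using mu_pos[of "s l"] by simp
    ultimately show ?thesis using step[OF assms, of "s l"] unfolding right_diff_distrib by linarith
  qed
  moreover have "(\<lambda>l. lam * (lin (X (s l)) W - lin (X (s l)) (X (Suc (s l))))
      + (ip (t_diff W (Yt (s l))) (gf (Zt (s l))) - ip (t_diff (X (Suc (s l))) (Yt (s l))) (gf (Zt (s l))))
      + \<mu> 0 / 2 * (nrm (t_diff W (Yt (s l))))\<^sup>2) \<longlonglongrightarrow>
      lam * (lin Xs W - lin Xs Xs) + (ip (t_diff W Xs) (gf Xs) - ip (t_diff Xs Xs) (gf Xs))
      + \<mu> 0 / 2 * (nrm (t_diff W Xs))\<^sup>2"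
    by (intro tendsto_add tendsto_diff tendsto_mult tendsto_power tendsto_const tendsto_lin
        tendsto_t_inner tendsto_t_norm tendsto_t_diff lim next_tendsto extrapolations_tendsto gradient_tendsto)
  ultimately have "0 \<le> lam * (lin Xs W - lin Xs Xs) + (ip (t_diff W Xs) (gf Xs) - ip (t_diff Xs Xs) (gf Xs))
      + \<mu> 0 / 2 * (nrm (t_diff W Xs))\<^sup>2" by (intro LIMSEQ_le_const) auto
  then show ?thesis by (simp add: t_inner_diff_left)
qed

text \<open>Minimality in the limit bounds the linearized change of \<open>F\<close> from below by
  \<open>- \<mu> 0 / 2\<close> times the squared distance; the two other constants are the
  linearization errors of \<open>reg\<close> and \<open>f\<close>.\<close>

lemma limit_quadratic_minorant:
  assumes W: "W \<in> T"
  shows "F Xs - (lam * reg_const + Lf / 2 + \<mu> 0 / 2) * (nrm (t_diff W Xs))\<^sup>2 \<le> F W"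
proof -
  let ?D = "(nrm (t_diff W Xs))\<^sup>2"
  have "lam * (lin Xs W - lin Xs Xs - reg_const * ?D) \<le> lam * (reg W - reg Xs)"
    using reg_above_linearization lam_pos by (intro mult_left_mono) auto
  moreover have "f W \<ge> f Xs + ip (t_diff W Xs) (gf Xs) - Lf / 2 * ?D"
    using f_quadratic[OF limit_tensor W] unfolding t_inner_commute[of _ _ _ "gf Xs"] abs_le_iff by simp
  ultimately show ?thesis using limit_minimizes[OF W] unfolding F_eq by (simp add: algebra_simps)
qed

lemma zero_frechet_subgradient: "t_zero \<in> frechet_subdiff n1 n2 n3 F Xs"
  unfolding frechet_subdiff_def
proof (intro CollectI conjI allI impI)
  show "t_zero \<in> T" by (simp add: t_zero_def tensors_def)
  fix e :: real assume e: "e > 0"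
  \<comment> \<open>A positive bound on the curvature; within radius \<open>e / C\<close> the
    quadratic loss is at most \<open>e\<close> times the distance.\<close>
  define C where "C = \<bar>lam * reg_const + Lf / 2 + \<mu> 0 / 2\<bar> + 1"
  have C: "C > 0" "lam * reg_const + Lf / 2 + \<mu> 0 / 2 \<le> C" by (auto simp: C_def)
  show "\<exists>\<delta>>0. \<forall>Y\<in>T. nrm (t_diff Y Xs) < \<delta> \<longrightarrow>
      F Xs + ip t_zero (t_diff Y Xs) - e * nrm (t_diff Y Xs) \<le> F Y"
  proof (intro exI[of _ "e / C"] conjI ballI impI)
    show "e / C > 0" using e C by simp
    fix Y assume Y: "Y \<in> T" "nrm (t_diff Y Xs) < e / C"
    let ?D = "nrm (t_diff Y Xs)"
    have "(lam * reg_const + Lf / 2 + \<mu> 0 / 2) * ?D\<^sup>2 \<le> C * ?D\<^sup>2"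
      using C(2) by (rule mult_right_mono) simp
    also have "\<dots> = C * ?D * ?D" by (simp add: power2_eq_square)
    also have "\<dots> \<le> e * ?D"
      using Y(2) C(1) by (intro mult_right_mono) (auto simp: field_simps)
    finally have "(lam * reg_const + Lf / 2 + \<mu> 0 / 2) * ?D\<^sup>2 \<le> e * ?D" .
    moreover have "ip t_zero (t_diff Y Xs) = 0" by (simp add: t_inner_def t_zero_def)
    ultimately show "F Xs + ip t_zero (t_diff Y Xs) - e * ?D \<le> F Y"
      using limit_quadratic_minorant[OF Y(1)] by linarith
  qed
qed

text \<open>The constant sequences at \<open>Xs\<close> and \<open>t_zero\<close> witness that a
  Frechet subgradient is a limiting one.\<close>

lemma limit_stationary: "t_zero \<in> limiting_subdiff n1 n2 n3 F Xs"
  unfolding limiting_subdiff_def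
proof (intro CollectI conjI exI)
  show "t_zero \<in> T" by (simp add: t_zero_def tensors_def)
  show "\<forall>t::nat. Xs \<in> T \<and> t_zero \<in> frechet_subdiff n1 n2 n3 F Xs"
    using zero_frechet_subgradient limit_tensor by simp
qed simp_all

lemma limit_value: "(\<lambda>l. F (X (Suc (s l)))) \<longlonglongrightarrow> F Xs"
  by (rule tendsto_F[OF next_tendsto _ limit_tensor]) simp

end

end

section \<open>Boundedness, convergence of values and stationarity combined\<close>

theorem theorem2:
  fixes n1 n2 n3 :: nat
    and \<rho> d\<rho> :: "real \<Rightarrow> real" and Lg :: real
    and f :: "tensor \<Rightarrow> real" and gf :: "tensor \<Rightarrow> tensor" and Lf :: real
    and lam \<epsilon> :: real
    and \<theta>1 \<theta>2 \<mu> :: "nat \<Rightarrow> real"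
    and X :: "nat \<Rightarrow> tensor"
  assumes dims: "n1 > 0" "n2 > 0" "n3 > 0"
    \<comment> \<open>A1\<close>
    and rho_nonneg: "\<forall>t\<ge>0. \<rho> t \<ge> 0"
    and rho_deriv: "\<forall>t\<ge>0. (\<rho> has_real_derivative d\<rho> t) (at t within {0..})"
    and rho_concave: "concave_on {0..} \<rho>"
    and drho_lip: "\<forall>s\<ge>0. \<forall>t\<ge>0. \<bar>d\<rho> s - d\<rho> t\<bar> \<le> Lg * \<bar>s - t\<bar>"
    and drho_pos: "\<forall>t\<ge>0. d\<rho> t > 0"
    \<comment> \<open>A2\<close>
    and f_nonneg: "\<forall>Y\<in>tensors n1 n2 n3. f Y \<ge> 0"
    and gf_tensor: "\<forall>Y\<in>tensors n1 n2 n3. gf Y \<in> tensors n1 n2 n3"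
    and f_grad: "\<forall>Y\<in>tensors n1 n2 n3. \<forall>e>0. \<exists>d>0. \<forall>W\<in>tensors n1 n2 n3.
        t_norm n1 n2 n3 (t_diff W Y) < d \<longrightarrow>
        \<bar>f W - f Y - t_inner n1 n2 n3 (gf Y) (t_diff W Y)\<bar> \<le> e * t_norm n1 n2 n3 (t_diff W Y)"
    and Lf_pos: "Lf > 0"
    and gf_lip: "\<forall>Y\<in>tensors n1 n2 n3. \<forall>W\<in>tensors n1 n2 n3.
        t_norm n1 n2 n3 (t_diff (gf Y) (gf W)) \<le> Lf * t_norm n1 n2 n3 (t_diff Y W)"
    \<comment> \<open>objective parameter and A3\<close>
    and lam_pos: "lam > 0"
    and F_coercive: "\<forall>M. \<exists>R. \<forall>Y\<in>tensors n1 n2 n3.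
        t_norm n1 n2 n3 Y \<ge> R \<longrightarrow> objF n1 n2 n3 \<rho> lam f Y \<ge> M"
    and F_bdd_below: "\<exists>c. \<forall>Y\<in>tensors n1 n2 n3. objF n1 n2 n3 \<rho> lam f Y \<ge> c"
    \<comment> \<open>A4\<close>
    and eps: "0 < \<epsilon>" "\<epsilon> < 1"
    and theta1: "\<forall>t. 0 \<le> \<theta>1 t \<and> \<theta>1 t < (1 - \<epsilon>) / 2"
    and theta2: "\<forall>t. 0 \<le> \<theta>2 t \<and> \<theta>2 t \<le> 1 / 2"
    and mu_mono: "\<forall>t. \<mu> (Suc t) \<le> \<mu> t"
    and mu_le: "\<forall>t. \<mu> t \<le> \<mu> 0"
    and mu_ge1: "\<forall>t. \<theta>2 t * Lf \<le> \<mu> t * \<theta>1 t"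
    and mu_ge2: "\<forall>t. (1 - \<theta>2 t) * Lf / (1 - \<theta>1 t - \<theta>1 (Suc t) - \<epsilon>) \<le> \<mu> t"
    \<comment> \<open>TNNR iteration (with X^{-1} = X^0)\<close>
    and X_tensor: "\<forall>t. X t \<in> tensors n1 n2 n3"
    and X_step: "\<forall>t. \<forall>W\<in>tensors n1 n2 n3.
        (let Xp = (if t = 0 then X 0 else X (t - 1));
             Y = t_extrap (X t) (\<theta>1 t) Xp;
             Z = t_extrap (X t) (\<theta>2 t) Xp;
             \<alpha> = (\<lambda>k. d\<rho> (\<Sum>i<min n1 n2. \<rho> (\<rho> (tsv n1 n2 n3 (X t) i k))));
             \<beta> = (\<lambda>i k. d\<rho> (\<rho> (tsv n1 n2 n3 (X t) i k)));
             obj = (\<lambda>V. lam * wnorm n1 n2 n3 \<rho> \<alpha> \<beta> V + t_inner n1 n2 n3 (t_diff V Y) (gf Z)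
                        + \<mu> t / 2 * (t_norm n1 n2 n3 (t_diff V Y))\<^sup>2)
         in obj (X (Suc t)) \<le> obj W)"
  shows "(\<exists>B. \<forall>t. t_norm n1 n2 n3 (X t) \<le> B)
    \<and> (\<exists>Xs s. strict_mono s \<and> (\<lambda>l. X (s l)) \<longlonglongrightarrow> Xs)
    \<and> convergent (\<lambda>t. objF n1 n2 n3 \<rho> lam f (X t))
    \<and> (\<forall>Xs s. strict_mono s \<and> (\<lambda>l. X (s l)) \<longlonglongrightarrow> Xs \<longrightarrow>
          t_zero \<in> limiting_subdiff n1 n2 n3 (objF n1 n2 n3 \<rho> lam f) Xs
        \<and> (\<lambda>l. objF n1 n2 n3 \<rho> lam f (X (Suc (s l)))) \<longlonglongrightarrow> objF n1 n2 n3 \<rho> lam f Xs)"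
proof -
  interpret tnnr \<rho> d\<rho> Lg n1 n2 n3 f gf Lf lam \<epsilon> \<theta>1 \<theta>2 \<mu> X
    by unfold_locales (fact gf_tensor f_grad Lf_pos gf_lip lam_pos F_coercive F_bdd_below eps theta1
        theta2 mu_mono mu_le mu_ge1 mu_ge2 X_tensor X_step rho_concave
      | use rho_nonneg rho_deriv drho_lip drho_pos in blast)+
  obtain B where B: "\<And>t. t_norm n1 n2 n3 (X t) \<le> B" using iterates_bounded by blast
  obtain Xs s where "strict_mono s" "(\<lambda>l. X (s l)) \<longlonglongrightarrow> Xs"
    by (rule bounded_tensors_convergent_subseq[OF tensor_mem(1) B])
  then show ?thesis
    using iterates_bounded F_convergent limit_stationary limit_value by blast
qed

end
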